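(* Let $(x_1,x_2,x_3)$ be a good triple with $x_1^2+x_2^2+x_3^2-x_1x_2x_3\ne4$. Then the group $G$ generated by the three reflections $R_1,R_2,R_3$ attached to it is an irreducible finite Coxeter group.
   Context: Let $V$ be a real three-dimensional space with basis $e_1,e_2,e_3$ and symmetric bilinear form $(e_i,e_i)=2$, $(e_1,e_2)=x_1$, $(e_2,e_3)=x_2$, $(e_1,e_3)=x_3$; $R_i(v)=v-(e_i,v)e_i$, and $G\subset O(V,(\cdot,\cdot))$ is generated by $R_1,R_2,R_3$. The braid group $B_3=\langle\beta_1,\beta_2\mid\beta_1\beta_2\beta_1=\beta_2\beta_1\beta_2\rangle$ acts on triples by $\beta_1:(x_1,x_2,x_3)\mapsto(-x_1,x_3-x_1x_2,x_2)$, $\beta_2:(x_1,x_2,x_3)\mapsto(x_3,-x_2,x_1-x_2x_3)$. A triple is admissible if at most one coordinate is zero. An admissible triple is good if for every $\beta\in B_3$ one has $\beta(x_1,x_2,x_3)=(-2\cos\pi r_1^\beta,-2\cos\pi r_2^\beta,-2\cos\pi r_3^\beta)$ with rational $0\le r_i^\beta\le1$. *)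

theory Defs
  imports "HOL-Analysis.Analysis" "HOL-Algebra.Elementary_Groups"
begin

section \<open>Group presentations\<close>

text \<open>Group words are lists of signed letters: \<open>(a, True)\<close> stands for \<open>a\<close> and
  \<open>(a, False)\<close> for its inverse. The relation \<open>word_eq R\<close> is equality in the group
  presented by the letters, subject to \<open>r = 1\<close> for all \<open>r\<close> in \<open>R\<close>.\<close>

type_synonym 'a group_word = "('a \<times> bool) list"

inductive word_eq :: "'a group_word set \<Rightarrow> 'a group_word \<Rightarrow> 'a group_word \<Rightarrow> bool"
  for R :: "'a group_word set" where
  refl: "word_eq R u u"
| sym: "word_eq R u v \<Longrightarrow> word_eq R v u"
| trans: "word_eq R u v \<Longrightarrow> word_eq R v w \<Longrightarrow> word_eq R u w"
| append: "word_eq R u u' \<Longrightarrow> word_eq R v v' \<Longrightarrow> word_eq R (u @ v) (u' @ v')"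
| cancel: "word_eq R [(a, b), (a, \<not> b)] []"
| relator: "r \<in> R \<Longrightarrow> word_eq R r []"

primrec word_eval :: "('a, 'm) monoid_scheme \<Rightarrow> 'a group_word \<Rightarrow> 'a" where
  "word_eval G [] = \<one>\<^bsub>G\<^esub>"
| "word_eval G (x # w) =
    (if snd x then fst x else m_inv G (fst x)) \<otimes>\<^bsub>G\<^esub> word_eval G w"

section \<open>Coxeter systems\<close>

text \<open>An entry 0 of a Coxeter matrix stands for infinity; the corresponding relator is
  then the empty word.\<close>

definition coxeter_matrix :: "'a set \<Rightarrow> ('a \<Rightarrow> 'a \<Rightarrow> nat) \<Rightarrow> bool" where
  "coxeter_matrix S m \<longleftrightarrow>
    (\<forall>s\<in>S. m s s = 1) \<and> (\<forall>s\<in>S. \<forall>t\<in>S. m s t = m t s) \<and>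
    (\<forall>s\<in>S. \<forall>t\<in>S. s \<noteq> t \<longrightarrow> m s t \<noteq> 1)"

definition coxeter_relators :: "'a set \<Rightarrow> ('a \<Rightarrow> 'a \<Rightarrow> nat) \<Rightarrow> 'a group_word set" where
  "coxeter_relators S m =
    {concat (replicate (m s t) [(s, True), (t, True)]) | s t. s \<in> S \<and> t \<in> S}"

definition coxeter_system ::
  "('a, 'm) monoid_scheme \<Rightarrow> 'a set \<Rightarrow> ('a \<Rightarrow> 'a \<Rightarrow> nat) \<Rightarrow> bool" where
  "coxeter_system G S m \<longleftrightarrow>
    group G \<and> S \<subseteq> carrier G \<and> generate G S = carrier G \<and> coxeter_matrix S m \<and>
    (\<forall>w \<in> lists (S \<times> UNIV). word_eval G w = \<one>\<^bsub>G\<^esub> \<longleftrightarrow> word_eq (coxeter_relators S m) w [])"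

text \<open>Irreducibility: the Coxeter graph is nonempty and connected.\<close>

definition coxeter_graph :: "'a set \<Rightarrow> ('a \<Rightarrow> 'a \<Rightarrow> nat) \<Rightarrow> ('a \<times> 'a) set" where
  "coxeter_graph S m = {(s, t). s \<in> S \<and> t \<in> S \<and> s \<noteq> t \<and> m s t \<noteq> 2}"

definition coxeter_irreducible :: "'a set \<Rightarrow> ('a \<Rightarrow> 'a \<Rightarrow> nat) \<Rightarrow> bool" where
  "coxeter_irreducible S m \<longleftrightarrow>
    S \<noteq> {} \<and> (\<forall>s\<in>S. \<forall>t\<in>S. (s, t) \<in> (coxeter_graph S m)\<^sup>*)"

section \<open>The reflection group of a triple\<close>

type_synonym triple = "real \<times> real \<times> real"

definition gram :: "triple \<Rightarrow> real^3^3" where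
  "gram = (\<lambda>(x1, x2, x3). vector [vector [2, x1, x3], vector [x1, 2, x2], vector [x3, x2, 2]])"

definition bform :: "triple \<Rightarrow> real^3 \<Rightarrow> real^3 \<Rightarrow> real" where
  "bform x v w = (\<Sum>i\<in>UNIV. \<Sum>j\<in>UNIV. gram x $ i $ j * v $ i * w $ j)"

definition Refl :: "triple \<Rightarrow> 3 \<Rightarrow> real^3 \<Rightarrow> real^3" where
  "Refl x i v = v - bform x (axis i 1) v *\<^sub>R axis i 1"

definition orthogonal_group :: "triple \<Rightarrow> (real^3 \<Rightarrow> real^3) monoid" where
  "orthogonal_group x =
    \<lparr>carrier = {f. linear f \<and> bij f \<and> (\<forall>v w. bform x (f v) (f w) = bform x v w)},
     mult = (\<circ>), one = id\<rparr>"

definition reflection_group :: "triple \<Rightarrow> (real^3 \<Rightarrow> real^3) monoid" where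
  "reflection_group x = subgroup_generated (orthogonal_group x) {Refl x 1, Refl x 2, Refl x 3}"

definition reflections :: "triple \<Rightarrow> (real^3 \<Rightarrow> real^3) set" where
  "reflections x = {\<lambda>v. v - (2 * bform x a v / bform x a a) *\<^sub>R a | a. bform x a a \<noteq> 0}"

text \<open>Irreducibility of a Coxeter group refers to a Coxeter system on it. The Coxeter
  generators are required to be reflections of the space, since the abstract group alone does
  not determine the type: the dihedral group of order 12 is of type \<open>G\<^sub>2\<close>, but it is also
  the reducible reflection group of type \<open>A\<^sub>1 \<times> A\<^sub>2\<close>. They need not be
  \<open>Refl x 1\<close>, \<open>Refl x 2\<close>, \<open>Refl x 3\<close>.\<close>

definition irreducible_finite_coxeter_group ::
  "triple \<Rightarrow> (real^3 \<Rightarrow> real^3) monoid \<Rightarrow> bool" where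
  "irreducible_finite_coxeter_group x G \<longleftrightarrow>
    finite (carrier G) \<and>
    (\<exists>S m. S \<subseteq> reflections x \<and> coxeter_system G S m \<and> coxeter_irreducible S m)"

lemma bform_axis_axis: "bform x (axis i 1) (axis j 1) = gram x $ i $ j"
  using exhaust_3[of i] exhaust_3[of j] by (auto simp: bform_def sum_3 axis_def)

lemma gram_diag: "gram x $ i $ i = 2"
  using exhaust_3[of i] by (auto simp: gram_def split: prod.splits)

lemma gram_sym: "gram x $ i $ j = gram x $ j $ i"
  using exhaust_3[of i] exhaust_3[of j] by (auto simp: gram_def split: prod.splits)

lemma bform_sym: "bform x v w = bform x w v"
  unfolding bform_def by (subst sum.swap) (simp add: gram_sym mult_ac)

lemma bform_diff_right: "bform x u (v - w) = bform x u v - bform x u w"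
  by (simp add: bform_def algebra_simps sum_subtractf)

lemma bform_scaleR_right: "bform x u (c *\<^sub>R v) = c * bform x u v"
  by (simp add: bform_def sum_distrib_left mult_ac)

lemma bform_add_right: "bform x u (v + w) = bform x u v + bform x u w"
  by (simp add: bform_def algebra_simps sum.distrib)

lemma Refl_involution: "Refl x i (Refl x i v) = v"
  by (simp add: Refl_def bform_diff_right bform_scaleR_right bform_axis_axis gram_diag)

lemma Refl_in_orthogonal_group: "Refl x i \<in> carrier (orthogonal_group x)"
proof -
  have "linear (Refl x i)"
    by (rule linearI)
      (simp_all add: Refl_def bform_add_right bform_scaleR_right algebra_simps)
  moreover have "bij (Refl x i)"
    by (rule o_bij[where g = "Refl x i"]) (auto simp: Refl_involution)
  moreover have "bform x (Refl x i v) (Refl x i w) = bform x v w" for v w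
  proof -
    have *: "bform x (Refl x i v) u = bform x v u - bform x (axis i 1) v * bform x (axis i 1) u" for u
      by (subst (1 2) bform_sym)
        (simp add: Refl_def bform_diff_right bform_scaleR_right bform_sym[of x _ "axis i 1"])
    show ?thesis
      by (simp add: *)
        (simp add: Refl_def bform_diff_right bform_scaleR_right bform_axis_axis gram_diag
          bform_sym[of x _ "axis i 1"])
  qed
  ultimately show ?thesis by (simp add: orthogonal_group_def)
qed

lemma Refl_in_reflections: "Refl x i \<in> reflections x"
  unfolding reflections_def
  by (rule CollectI, rule exI[of _ "axis i 1"])
    (auto simp: Refl_def bform_axis_axis gram_diag fun_eq_iff)

lemma group_orthogonal_group: "group (orthogonal_group x)"
proof (rule groupI)
  fix f assume f: "f \<in> carrier (orthogonal_group x)"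
  then have lin: "linear f" and bij: "bij f"
    and iso: "\<And>v w. bform x (f v) (f w) = bform x v w"
    by (auto simp: orthogonal_group_def)
  let ?g = "inv_into UNIV f"
  have fg: "f (?g v) = v" for v using bij by (simp add: bij_is_surj surj_f_inv_f)
  have "linear ?g"
    by (rule linearI; rule injD[OF bij_is_inj[OF bij]])
      (simp_all add: fg linear_add[OF lin] linear_scale[OF lin])
  moreover have "bform x (?g v) (?g w) = bform x v w" for v w
    using iso[of "?g v" "?g w"] by (simp add: fg)
  ultimately have "?g \<in> carrier (orthogonal_group x)"
    using bij by (simp add: orthogonal_group_def bij_imp_bij_inv)
  moreover have "?g \<circ> f = id" using bij by (simp add: bij_is_inj)
  ultimately show "\<exists>g\<in>carrier (orthogonal_group x).
      g \<otimes>\<^bsub>orthogonal_group x\<^esub> f = \<one>\<^bsub>orthogonal_group x\<^esub>"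
    by (auto simp: orthogonal_group_def)
qed (auto simp: orthogonal_group_def linear_compose linear_id bij_comp comp_assoc)

section \<open>The braid group on three strands and its action on triples\<close>

datatype braid_gen = Beta1 | Beta2

definition braid_relators :: "braid_gen group_word set" where
  "braid_relators =
    {[(Beta1, True), (Beta2, True), (Beta1, True),
      (Beta2, False), (Beta1, False), (Beta2, False)]}"

quotient_type braid3 = "braid_gen group_word" / "word_eq braid_relators"
  by (intro equivpI reflpI sympI transpI) (blast intro: word_eq.intros)+

primrec beta :: "braid_gen \<Rightarrow> triple \<Rightarrow> triple" where
  "beta Beta1 = (\<lambda>(x1, x2, x3). (- x1, x3 - x1 * x2, x2))"
| "beta Beta2 = (\<lambda>(x1, x2, x3). (x3, - x2, x1 - x2 * x3))"

primrec beta_inv :: "braid_gen \<Rightarrow> triple \<Rightarrow> triple" where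
  "beta_inv Beta1 = (\<lambda>(x1, x2, x3). (- x1, x3, x2 - x1 * x3))"
| "beta_inv Beta2 = (\<lambda>(x1, x2, x3). (x3 - x1 * x2, - x2, x1))"

lemma beta_beta_inv: "beta g (beta_inv g x) = x" "beta_inv g (beta g x) = x"
  by (cases g; cases x; simp add: algebra_simps)+

primrec word_act :: "braid_gen group_word \<Rightarrow> triple \<Rightarrow> triple" where
  "word_act [] x = x"
| "word_act (l # w) x = (if snd l then beta (fst l) else beta_inv (fst l)) (word_act w x)"

lemma word_act_append: "word_act (u @ v) x = word_act u (word_act v x)"
  by (induction u) auto

lemma word_act_cong: "word_eq braid_relators u v \<Longrightarrow> word_act u x = word_act v x"
proof (induction arbitrary: x rule: word_eq.induct)
  case (relator r)
  then show ?case
    by (cases x) (simp add: braid_relators_def algebra_simps power2_eq_square)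
qed (auto simp: word_act_append beta_beta_inv)

lift_definition braid_act :: "braid3 \<Rightarrow> triple \<Rightarrow> triple" is word_act
  by (rule ext) (rule word_act_cong)

section \<open>Good triples\<close>

definition admissible :: "triple \<Rightarrow> bool" where
  "admissible = (\<lambda>(x1, x2, x3).
    \<not> (x1 = 0 \<and> x2 = 0) \<and> \<not> (x2 = 0 \<and> x3 = 0) \<and> \<not> (x1 = 0 \<and> x3 = 0))"

definition good :: "triple \<Rightarrow> bool" where
  "good x \<longleftrightarrow> admissible x \<and>
    (\<forall>\<beta>. \<exists>r1\<in>\<rat>. \<exists>r2\<in>\<rat>. \<exists>r3\<in>\<rat>.
      0 \<le> r1 \<and> r1 \<le> 1 \<and> 0 \<le> r2 \<and> r2 \<le> 1 \<and> 0 \<le> r3 \<and> r3 \<le> 1 \<and>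
      braid_act \<beta> x = (- 2 * cos (pi * r1), - 2 * cos (pi * r2), - 2 * cos (pi * r3)))"

end

theory Submission
  imports Defs "HOL-Algebra.Multiplicative_Group"
    "HOL-Computational_Algebra.Fundamental_Theorem_Algebra"
begin

text \<open>
  The braid action preserves \<open>Q = x\<^sub>1\<^sup>2 + x\<^sub>2\<^sup>2 + x\<^sub>3\<^sup>2 - x\<^sub>1 x\<^sub>2 x\<^sub>3\<close>, and the Gram determinant is
  \<open>2 (4 - Q)\<close>. If a whole orbit lies in \<open>[-2, 2]\<^sup>3\<close>, then looking at a point of the orbit
  closure with \<open>\<bar>x\<^sub>1\<bar> + \<bar>x\<^sub>2\<bar> + \<bar>x\<^sub>3\<bar>\<close> maximal gives \<open>Q \<le> 4\<close>, so for \<open>Q \<noteq> 4\<close> the form is positive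
  definite. Being of the form \<open>-2 cos (\<pi> r)\<close> with rational \<open>r\<close> is an algebraic condition with
  integer coefficients, hence every Galois conjugate of a good triple also has its orbit in
  \<open>[-2, 2]\<^sup>3\<close>, and all conjugate forms are positive definite. The coordinates of the roots are
  integers of a cyclotomic field all of whose conjugates are bounded, so there are finitely many
  roots and the group is finite. No classification of the finite orbits is needed: a finite
  reflection group has a simple system, its simple reflections satisfy the exchange condition and
  thus form a Coxeter system (Tits), and admissibility of the triple makes it irreducible.
\<close>

section \<open>The exchange condition and Coxeter presentations\<close>

text \<open>The orbit of a good triple is not known to be finite in advance, so the maximum is taken
  over its closure: angles may stop being rational there, but the cube, the braid moves and Q
  survive the limit. The test for a rational angle that survives conjugation is the equation
  \<open>cheb k a = 2\<close> with \<open>k > 0\<close>: it has integer coefficients, and every real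
  solution satisfies \<open>\<bar>a\<bar> \<le> 2\<close>. Instead of a Galois group there are
  integer polynomial functions on the n-th roots of unity for triples and roots, and a relation
  \<open>conjugate\<close> between zeros of the same rational polynomials; an equation at \<zeta>
  becomes the same equation at z. The three given reflections generate the group but need not be the
  walls of a chamber: for the triple (1, 1, 1) they act as the transpositions (12), (13), (14) of
  \<open>S_4\<close>. This is why the Coxeter generators come from a separately chosen simple
  system.\<close>

definition word_prod :: "('a, 'm) monoid_scheme \<Rightarrow> 'a list \<Rightarrow> 'a" where
  "word_prod G w = foldr (\<otimes>\<^bsub>G\<^esub>) w \<one>\<^bsub>G\<^esub>"

definition reduced_word :: "('a, 'm) monoid_scheme \<Rightarrow> 'a set \<Rightarrow> 'a list \<Rightarrow> bool" where
  "reduced_word G S w \<longleftrightarrow> w \<in> lists S \<and>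
    (\<forall>v \<in> lists S. word_prod G v = word_prod G w \<longrightarrow> length w \<le> length v)"

definition delete_at :: "nat \<Rightarrow> 'a list \<Rightarrow> 'a list" where
  "delete_at i w = take i w @ drop (Suc i) w"

lemma delete_at_in_lists: "w \<in> lists S \<Longrightarrow> delete_at i w \<in> lists S"
  by (auto simp: delete_at_def dest: in_set_takeD in_set_dropD)

lemma length_delete_at: "i < length w \<Longrightarrow> Suc (length (delete_at i w)) = length w"
  by (simp add: delete_at_def)

primrec alt_word :: "nat \<Rightarrow> 'a \<Rightarrow> 'a \<Rightarrow> 'a list" where
  "alt_word 0 s t = []"
| "alt_word (Suc k) s t = s # alt_word k t s"

lemma length_alt_word [simp]: "length (alt_word k s t) = k"
  by (induction k arbitrary: s t) auto

lemma alt_word_in_lists: "s \<in> S \<Longrightarrow> t \<in> S \<Longrightarrow> alt_word k s t \<in> lists S"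
  by (induction k arbitrary: s t) auto

lemma alt_word_snoc:
  "alt_word (Suc k) s t = alt_word k s t @ [if even k then s else t]"
  by (induction k arbitrary: s t) auto

lemma concat_replicate_snoc:
  "x # concat (replicate k [y, x]) @ [y] = concat (replicate (Suc k) [x, y])"
  by (induction k) auto

text \<open>For involutions \<open>s\<close>, \<open>t\<close> this links the two shapes of a
  dihedral relation: the two alternating words of length \<open>k\<close> agree exactly when
  \<open>(s t) ^ k = 1\<close>.\<close>

lemma alt_word_append_rev:
  "alt_word k s t @ rev (alt_word k t s) = concat (replicate k [s, t])"
proof (induction k arbitrary: s t)
  case (Suc k)
  have "alt_word (Suc k) s t @ rev (alt_word (Suc k) t s)
      = s # (alt_word k t s @ rev (alt_word k s t)) @ [t]" by simp
  then show ?case by (simp only: Suc concat_replicate_snoc)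
qed simp

text \<open>\<open>desc g s\<close> abstracts that \<open>g\<close> makes the simple root of
  \<open>s\<close> negative. It is a sign, not a comparison of lengths, so both assumptions on it
  can be checked on roots; \<open>desc_deletion\<close> is asked of all words, reduced or
  not.\<close>

locale descent_group = group G for G (structure) +
  fixes S :: "'a set" and desc :: "'a \<Rightarrow> 'a \<Rightarrow> bool"
  assumes S_carrier: "S \<subseteq> carrier G"
    and S_generate: "generate G S = carrier G"
    and S_involution: "s \<in> S \<Longrightarrow> s \<otimes> s = \<one>"
    and desc_cases: "g \<in> carrier G \<Longrightarrow> s \<in> S \<Longrightarrow> desc g s \<or> desc (g \<otimes> s) s"
    and desc_deletion: "w \<in> lists S \<Longrightarrow> s \<in> S \<Longrightarrow> desc (word_prod G w) s \<Longrightarrow>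
      \<exists>i < length w. word_prod G w \<otimes> s = word_prod G (delete_at i w)"
begin

abbreviation ev :: "'a list \<Rightarrow> 'a" where "ev \<equiv> word_prod G"

abbreviation red :: "'a list \<Rightarrow> bool" where "red \<equiv> reduced_word G S"

text \<open>\<open>ord\<close> is 0 for elements of infinite order, in agreement with the convention
  that the entry 0 stands for infinity.\<close>

definition cmat :: "'a \<Rightarrow> 'a \<Rightarrow> nat" where "cmat s t = ord (s \<otimes> t)"

definition weq :: "'a list \<Rightarrow> 'a list \<Rightarrow> bool" (infix "\<cong>\<^sub>S" 50) where
  "u \<cong>\<^sub>S v \<longleftrightarrow> word_eq (coxeter_relators S cmat)
     (map (\<lambda>s. (s, True)) u) (map (\<lambda>s. (s, True)) v)"

lemma S_closed [simp]: "s \<in> S \<Longrightarrow> s \<in> carrier G"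
  using S_carrier by auto

lemma ev_Nil [simp]: "ev [] = \<one>" and ev_Cons [simp]: "ev (s # w) = s \<otimes> ev w"
  by (simp_all add: word_prod_def)

lemma ev_closed: "w \<in> lists S \<Longrightarrow> ev w \<in> carrier G"
  by (induction w) auto

lemma ev_append: "u \<in> lists S \<Longrightarrow> v \<in> lists S \<Longrightarrow> ev (u @ v) = ev u \<otimes> ev v"
  by (induction u) (auto simp: ev_closed m_assoc)

lemma ev_snoc: "u \<in> lists S \<Longrightarrow> s \<in> S \<Longrightarrow> ev (u @ [s]) = ev u \<otimes> s"
  by (simp add: ev_append)

lemma S_inv: "s \<in> S \<Longrightarrow> inv s = s"
  using S_involution inv_equality by simp

lemma ev_rev: "u \<in> lists S \<Longrightarrow> ev (rev u) = inv (ev u)"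
proof (induction u)
  case (Cons s u)
  then have "ev (rev u @ [s]) = ev (rev u) \<otimes> s" by (intro ev_snoc) auto
  then show ?case using Cons by (auto simp: ev_closed inv_mult_group S_inv)
qed simp

lemma mult_S_S: "g \<in> carrier G \<Longrightarrow> s \<in> S \<Longrightarrow> g \<otimes> s \<otimes> s = g"
  by (simp add: m_assoc S_involution)

lemma ev_replicate:
  "s \<in> S \<Longrightarrow> t \<in> S \<Longrightarrow> ev (concat (replicate k [s, t])) = (s \<otimes> t) [^] k"
proof (induction k)
  case (Suc k)
  then have "ev (concat (replicate (Suc k) [s, t])) = (s \<otimes> t) \<otimes> (s \<otimes> t) [^] k"
    by (simp add: m_assoc)
  then show ?case using Suc.prems nat_pow_Suc2[of "s \<otimes> t" k] by simp
qed simp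

lemma weq_refl: "u \<cong>\<^sub>S u" and weq_sym: "u \<cong>\<^sub>S v \<Longrightarrow> v \<cong>\<^sub>S u"
  and weq_trans: "u \<cong>\<^sub>S v \<Longrightarrow> v \<cong>\<^sub>S w \<Longrightarrow> u \<cong>\<^sub>S w"
  and weq_append: "u \<cong>\<^sub>S u' \<Longrightarrow> v \<cong>\<^sub>S v' \<Longrightarrow> u @ v \<cong>\<^sub>S u' @ v'"
  unfolding weq_def by (auto intro: word_eq.intros)

lemma weq_replicate_cmat:
  assumes "s \<in> S" "t \<in> S"
  shows "concat (replicate (cmat s t) [s, t]) \<cong>\<^sub>S []"
proof -
  have "map (\<lambda>s. (s, True)) (concat (replicate n [s, t])) =
      concat (replicate n [(s, True), (t, True)])" for n
    by (induction n) auto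
  then show ?thesis unfolding weq_def using assms
    by (auto intro!: word_eq.relator simp: coxeter_relators_def)
qed

lemma weq_replicate:
  assumes "s \<in> S" "t \<in> S" "(s \<otimes> t) [^] k = \<one>"
  shows "concat (replicate k [s, t]) \<cong>\<^sub>S []"
proof -
  obtain j where j: "k = cmat s t * j"
    using assms pow_eq_id[of "s \<otimes> t" k] by (auto simp: cmat_def)
  have "concat (replicate (cmat s t * j) [s, t]) \<cong>\<^sub>S []"
  proof (induction j)
    case (Suc j)
    have "concat (replicate (cmat s t * Suc j) [s, t]) =
        concat (replicate (cmat s t) [s, t]) @ concat (replicate (cmat s t * j) [s, t])"
      by (simp add: replicate_add)
    then show ?case using weq_append[OF weq_replicate_cmat[OF assms(1,2)] Suc] by simp
  qed (simp add: weq_refl)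
  then show ?thesis by (simp add: j)
qed

lemma weq_double: "s \<in> S \<Longrightarrow> [s, s] \<cong>\<^sub>S []"
  using weq_replicate[of s s 1] by (simp add: S_involution)

lemma weq_rev_append: "u \<in> lists S \<Longrightarrow> rev u @ u \<cong>\<^sub>S []"
proof (induction u)
  case (Cons s u)
  have "rev u @ [s, s] @ u \<cong>\<^sub>S rev u @ [] @ u"
    using Cons by (intro weq_append weq_refl weq_double) auto
  then have "rev (s # u) @ s # u \<cong>\<^sub>S rev u @ u" by simp
  moreover have "rev u @ u \<cong>\<^sub>S []" using Cons by simp
  ultimately show ?case by (rule weq_trans)
qed (simp add: weq_refl)

text \<open>Appending the reverse of the second word turns the equation into
  \<open>(s \<otimes> t) [^] k = \<one>\<close>, hence into a power of a relator. So every braid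
  relation that holds in the group follows from the presentation.\<close>

lemma weq_alt_word:
  assumes "s \<in> S" "t \<in> S" "ev (alt_word k s t) = ev (alt_word k t s)"
  shows "alt_word k s t \<cong>\<^sub>S alt_word k t s"
proof -
  let ?u = "alt_word k s t" and ?v = "alt_word k t s"
  have l: "?u \<in> lists S" "?v \<in> lists S" using assms by (simp_all only: alt_word_in_lists)
  have "ev (concat (replicate k [s, t])) = \<one>"
    using ev_append[of ?u "rev ?v"] ev_rev[OF l(2)] ev_closed[OF l(2)] l assms(3)
      r_inv[OF ev_closed[OF l(2)]]
    unfolding alt_word_append_rev[symmetric] by (auto simp: in_lists_conv_set)
  then have "?u @ rev ?v \<cong>\<^sub>S []"
    using assms by (simp add: alt_word_append_rev ev_replicate weq_replicate)
  then have "(?u @ rev ?v) @ ?v \<cong>\<^sub>S [] @ ?v" by (rule weq_append[OF _ weq_refl])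
  moreover have "?u @ (rev ?v @ ?v) \<cong>\<^sub>S ?u @ []" by (intro weq_append weq_refl weq_rev_append l)
  ultimately show ?thesis using weq_sym[of "?u @ rev ?v @ ?v" ?u] weq_trans[of ?u "?u @ rev ?v @ ?v" ?v]
    by simp
qed

section \<open>Reduced words and Tits' solution of the word problem\<close>

lemma red_lists: "red w \<Longrightarrow> w \<in> lists S"
  by (simp add: reduced_word_def)

lemma red_le: "red w \<Longrightarrow> v \<in> lists S \<Longrightarrow> ev v = ev w \<Longrightarrow> length w \<le> length v"
  by (simp add: reduced_word_def)

lemma red_same: "red w \<Longrightarrow> v \<in> lists S \<Longrightarrow> ev v = ev w \<Longrightarrow> length v = length w \<Longrightarrow> red v"
  by (simp add: reduced_word_def)

lemma red_appendD:
  assumes "red (u @ v)" shows "red u" "red v"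
proof -
  have l: "u \<in> lists S" "v \<in> lists S" using red_lists[OF assms] by auto
  have "length u \<le> length w" if "w \<in> lists S" "ev w = ev u" for w
    using red_le[OF assms, of "w @ v"] that l by (simp add: ev_append)
  moreover have "length v \<le> length w" if "w \<in> lists S" "ev w = ev v" for w
    using red_le[OF assms, of "u @ w"] that l by (simp add: ev_append)
  ultimately show "red u" "red v" using l by (simp_all add: reduced_word_def)
qed

text \<open>If \<open>s\<close> is no descent of \<open>v\<close>, it is one of \<open>v s\<close>.
  A word for \<open>v s\<close> no longer than \<open>v\<close> would then lose a letter by deletion
  and become a word for \<open>v\<close> shorter than \<open>v\<close>.\<close>

lemma red_snoc_or_desc:
  assumes "red v" "s \<in> S"
  shows "red (v @ [s]) \<or> desc (ev v) s"
proof (rule disjCI)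
  assume nd: "\<not> desc (ev v) s"
  have l: "v \<in> lists S" using assms red_lists by auto
  have d: "desc (ev (v @ [s])) s"
    using desc_cases[of "ev v" s] nd l assms(2) by (auto simp: ev_snoc ev_closed)
  have "length (v @ [s]) \<le> length w" if w: "w \<in> lists S" "ev w = ev (v @ [s])" for w
  proof (rule ccontr)
    assume short: "\<not> ?thesis"
    obtain i where i: "i < length w" "ev w \<otimes> s = ev (delete_at i w)"
      using desc_deletion[of w s] w d assms by auto
    have "ev (delete_at i w) = ev v"
      by (simp only: i(2)[symmetric] w(2) ev_snoc[OF l assms(2)] mult_S_S[OF ev_closed[OF l] assms(2)])
    then have "length v \<le> length (delete_at i w)"
      by (rule red_le[OF assms(1) delete_at_in_lists[OF w(1)]])
    then show False using short length_delete_at[OF i(1)] by simp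
  qed
  then show "red (v @ [s])" using l assms by (auto simp: reduced_word_def)
qed

text \<open>Deletion for \<open>s\<close> costs one letter and appending \<open>s\<close> restores
  it, so the new word for the same element again has minimal length.\<close>

lemma red_desc_exchange:
  assumes "red v" "s \<in> S" "desc (ev v) s"
  obtains i where "i < length v" "red (delete_at i v)" "red (delete_at i v @ [s])"
    "ev (delete_at i v @ [s]) = ev v"
proof -
  have l: "v \<in> lists S" using assms red_lists by auto
  obtain i where i: "i < length v" "ev v \<otimes> s = ev (delete_at i v)"
    using desc_deletion[of v s] l assms by auto
  let ?d = "delete_at i v"
  have dl: "?d \<in> lists S" using l by (rule delete_at_in_lists)
  have e: "ev (?d @ [s]) = ev v"
    by (simp only: ev_snoc[OF dl assms(2)] i(2)[symmetric] mult_S_S[OF ev_closed[OF l] assms(2)])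
  have r: "red (?d @ [s])"
    by (rule red_same[OF assms(1) _ e]) (use dl assms(2) length_delete_at[OF i(1)] in auto)
  show thesis using that[OF i(1) red_appendD(1)[OF r] r e] .
qed

text \<open>Tits' argument: two inequivalent reduced words \<open>u\<close>, \<open>v\<close> of the same element can
  only exchange the first letter of \<open>u\<close> for the last letter of \<open>v\<close>; iterating this makes
  both words alternate between two letters.\<close>

lemma exchange_step:
  assumes IH_all: "\<forall>u v. red u \<longrightarrow> red v \<longrightarrow> ev u = ev v \<longrightarrow> length u = k \<longrightarrow> u \<cong>\<^sub>S v"
    and u: "red u" "length u = Suc k" and v: "red v" "v = v' @ [t]"
    and eq: "ev u = ev v" and neq: "\<not> u \<cong>\<^sub>S v"
  shows "red (tl u @ [t])" "ev (tl u @ [t]) = ev u" "tl u @ [t] \<cong>\<^sub>S v"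
proof -
  note IH = IH_all[rule_format]
  have l: "u \<in> lists S" "v' \<in> lists S" "t \<in> S" using red_lists[OF u(1)] red_lists[OF v(1)] v(2) by auto
  have "\<not> red (u @ [t])"
  proof
    assume "red (u @ [t])"
    moreover have "ev v' = ev (u @ [t])"
      using l eq v by (simp add: ev_snoc mult_S_S ev_closed)
    ultimately have "length (u @ [t]) \<le> length v'" using red_le l by blast
    moreover have "length v \<le> length u" using red_le[OF v(1) l(1) eq] .
    ultimately show False using v by simp
  qed
  then have "desc (ev u) t" using red_snoc_or_desc u l by blast
  from red_desc_exchange[OF u(1) l(3) this] obtain i where
    i: "i < length u" "red (delete_at i u)" "red (delete_at i u @ [t])"
      "ev (delete_at i u @ [t]) = ev u" .
  let ?d = "delete_at i u"
  have dl: "?d \<in> lists S" using i(2) red_lists by blast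
  have "ev ?d = ev v'"
  proof -
    have "ev ?d \<otimes> t = ev v' \<otimes> t" using i(4) eq v dl l by (simp add: ev_snoc)
    then show ?thesis using dl l by (simp add: ev_closed)
  qed
  then have "?d \<cong>\<^sub>S v'"
    using IH[OF i(2) red_appendD(1)] v length_delete_at[OF i(1)] u by auto
  then have dv: "?d @ [t] \<cong>\<^sub>S v" unfolding v by (intro weq_append weq_refl)
  \<comment> \<open>Deletion at a later position would leave the first letter \<open>a\<close> in
    place. Cancelling \<open>a\<close> leaves two reduced words of length \<open>k\<close>,
    equivalent by \<open>IH_all\<close>, and \<open>u \<cong>\<^sub>S v\<close> would
    follow.\<close>
  have "i = 0"
  proof (rule ccontr)
    assume "i \<noteq> 0"
    obtain a u' where u': "u = a # u'" using u by (cases u) auto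
    obtain j where j: "i = Suc j" using \<open>i \<noteq> 0\<close> by (cases i) auto
    have del: "?d = a # delete_at j u'" by (simp add: u' j delete_at_def)
    have al: "a \<in> S" "u' \<in> lists S" using l u' by auto
    have dl': "delete_at j u' @ [t] \<in> lists S" using dl del l by auto
    have r1: "red u'" using red_appendD(2)[of "[a]" u'] u u' by simp
    have r2: "red (delete_at j u' @ [t])" using red_appendD(2)[of "[a]"] i(3) del by simp
    have "a \<otimes> ev u' = a \<otimes> ev (delete_at j u' @ [t])" using i(4) u' del by simp
    then have "ev u' = ev (delete_at j u' @ [t])" using al dl' ev_closed by simp
    then have "u' \<cong>\<^sub>S delete_at j u' @ [t]" using IH[OF r1 r2] u u' by simp
    then have "[a] @ u' \<cong>\<^sub>S [a] @ (delete_at j u' @ [t])" by (intro weq_append weq_refl)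
    then have "u \<cong>\<^sub>S v" using dv weq_trans del u' by simp
    then show False using neq by simp
  qed
  then have "?d = tl u" by (cases u) (auto simp: delete_at_def)
  then show "red (tl u @ [t])" "ev (tl u @ [t]) = ev u" "tl u @ [t] \<cong>\<^sub>S v"
    using i dv by simp_all
qed

lemma red_unique:
  "red u \<Longrightarrow> red v \<Longrightarrow> ev u = ev v \<Longrightarrow> length u = k \<Longrightarrow> u \<cong>\<^sub>S v"
proof (induction k arbitrary: u v)
  case 0
  then have "length v = 0" using red_le[of v u] red_lists by fastforce
  then show ?case using 0 by (simp add: weq_refl)
next
  case (Suc k)
  show ?case
  proof (rule ccontr)
    assume neq: "\<not> u \<cong>\<^sub>S v"
    have "length v = Suc k"
      using red_le[of v u] red_le[of u v] Suc.prems red_lists by force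
    then obtain v' t where v: "v = v' @ [t]" by (cases v rule: rev_cases) auto
    obtain u' s where us: "u = u' @ [s]"
      using Suc.prems by (cases u rule: rev_cases) auto
    have st: "s \<in> S" "t \<in> S" using us v Suc.prems red_lists by fastforce+
    \<comment> \<open>\<open>a j\<close> is \<open>u\<close> after \<open>j\<close> exchanges: the
      first \<open>j\<close> letters are gone and \<open>t\<close>, \<open>s\<close>,
      \<open>t\<close>, ... have been appended. Neighbours stay inequivalent, yet \<open>a k\<close>
      and \<open>a (Suc k)\<close> are both alternating.\<close>
    define a where "a j = drop j u @ alt_word j t s" for j
    have len: "j \<le> Suc k \<Longrightarrow> length (a j) = Suc k" for j
      using Suc.prems by (simp add: a_def)
    have last: "\<exists>b. a j = b @ [if even j then s else t]" if "j \<le> k" for j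
    proof (cases j)
      case 0
      then show ?thesis using us by (simp add: a_def)
    next
      case (Suc i)
      then show ?thesis by (simp add: a_def alt_word_snoc del: alt_word.simps)
    qed
    have next_a: "tl (a j) @ [if even j then t else s] = a (Suc j)" if "j \<le> k" for j
    proof -
      have "drop j u \<noteq> []" using that Suc.prems by simp
      then show ?thesis by (simp add: a_def alt_word_snoc drop_Suc tl_drop del: alt_word.simps)
    qed
    have IH: "\<forall>u v. red u \<longrightarrow> red v \<longrightarrow> ev u = ev v \<longrightarrow> length u = k \<longrightarrow> u \<cong>\<^sub>S v"
      using Suc.IH by blast
    note step = exchange_step[OF IH]
    have inv: "red (a j) \<and> red (a (Suc j)) \<and> ev (a j) = ev u \<and> ev (a (Suc j)) = ev u \<and>
        \<not> a j \<cong>\<^sub>S a (Suc j)" if "j \<le> k" for j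
      using that
    proof (induction j)
      case 0
      have "red (tl u @ [t])" "ev (tl u @ [t]) = ev u" "tl u @ [t] \<cong>\<^sub>S v"
        by (rule step[of u v v' t]; use Suc.prems v neq in simp)+
      moreover have "a 0 = u" "a (Suc 0) = tl u @ [t]"
        using next_a[of 0] by (simp_all add: a_def)
      ultimately show ?case using neq Suc.prems weq_trans[of u "tl u @ [t]" v] by auto
    next
      case (Suc j)
      then have j: "red (a j)" "red (a (Suc j))" "ev (a j) = ev u" "ev (a (Suc j)) = ev u"
        "\<not> a (Suc j) \<cong>\<^sub>S a j" "j \<le> k" using weq_sym by auto
      obtain b where b: "a j = b @ [if even j then s else t]" using last j by blast
      have tl: "tl (a (Suc j)) @ [if even j then s else t] = a (Suc (Suc j))"
        using next_a[of "Suc j"] Suc.prems by (simp split: if_splits)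
      \<comment> \<open>Here \<open>a (Suc j)\<close> plays \<open>u\<close> and the preceding word
        \<open>a j\<close> plays \<open>v\<close>. The new word is equivalent to \<open>a j\<close>,
        hence not to \<open>a (Suc j)\<close>.\<close>
      have "red (a (Suc (Suc j)))" "ev (a (Suc (Suc j))) = ev (a (Suc j))"
        "a (Suc (Suc j)) \<cong>\<^sub>S a j"
        using step[OF j(2) len[OF Suc.prems[THEN le_SucI]] j(1) b _ j(5), unfolded tl] j by auto
      then show ?case using j(2,4,5) weq_trans[of "a (Suc j)" "a (Suc (Suc j))" "a j"] by auto
    qed
    have "a (Suc k) = alt_word (Suc k) t s" using Suc.prems by (simp add: a_def)
    moreover have "a k = alt_word (Suc k) s t"
    proof -
      have "drop k u = [s]" using Suc.prems us by simp
      then show ?thesis by (simp add: a_def)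
    qed
    ultimately show False using inv[of k] weq_alt_word[OF st, of "Suc k"] by auto
  qed
qed

lemma weq_red: "w \<in> lists S \<Longrightarrow> \<exists>v. red v \<and> ev v = ev w \<and> w \<cong>\<^sub>S v"
proof (induction w rule: rev_induct)
  case Nil
  then show ?case by (intro exI[of _ "[]"]) (auto simp: reduced_word_def weq_refl)
next
  case (snoc s w)
  then obtain v where v: "red v" "ev v = ev w" "w \<cong>\<^sub>S v" by auto
  have l: "s \<in> S" "w \<in> lists S" "v \<in> lists S" using snoc v red_lists by auto
  have wv: "w @ [s] \<cong>\<^sub>S v @ [s]" "ev (v @ [s]) = ev (w @ [s])"
    using v l by (auto intro: weq_append weq_refl simp: ev_snoc)
  show ?case
  proof (cases "red (v @ [s])")
    case False
    then have "desc (ev v) s" using red_snoc_or_desc v l by blast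
    from red_desc_exchange[OF v(1) l(1) this] obtain i where
      i: "red (delete_at i v)" "red (delete_at i v @ [s])" "ev (delete_at i v @ [s]) = ev v" .
    let ?d = "delete_at i v"
    have dl: "?d \<in> lists S" using i red_lists by blast
    have "v \<cong>\<^sub>S ?d @ [s]" using red_unique[OF v(1) i(2)] i(3) by simp
    then have "v @ [s] \<cong>\<^sub>S (?d @ [s]) @ [s]" by (intro weq_append weq_refl)
    moreover have "?d @ [s, s] \<cong>\<^sub>S ?d @ []" using l by (intro weq_append weq_refl weq_double)
    ultimately have "v @ [s] \<cong>\<^sub>S ?d" using weq_trans[of "v @ [s]" "?d @ [s, s]" ?d] by simp
    then have "w @ [s] \<cong>\<^sub>S ?d" using wv weq_trans by blast
    moreover have "ev ?d = ev (w @ [s])"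
      using wv(2) l mult_S_S[of "ev ?d" s] by (simp add: ev_snoc ev_closed dl flip: i(3) v(2))
    ultimately show ?thesis using i by blast
  qed (use wv in blast)
qed

section \<open>Signed words and the Coxeter presentation\<close>

lemma word_eq_unsign:
  "w \<in> lists (S \<times> UNIV) \<Longrightarrow> word_eq (coxeter_relators S cmat) w (map (\<lambda>x. (fst x, True)) w)"
proof (induction w)
  case Nil
  then show ?case by (simp add: word_eq.refl)
next
  case (Cons x w)
  let ?eq = "word_eq (coxeter_relators S cmat)"
  obtain s b where x: "x = (s, b)" "s \<in> S" using Cons by auto
  have "?eq [x] [(s, True)]"
  proof (cases b)
    case False
    \<comment> \<open>In \<open>s s s^-1\<close>, cancelling the first two letters leaves the
      inverse letter, cancelling the last two leaves \<open>s\<close>.\<close>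
    have "?eq ([(s, True), (s, True)] @ [(s, False)]) ([] @ [(s, False)])"
      using weq_double[OF x(2)] by (intro word_eq.append word_eq.refl) (simp add: weq_def)
    moreover have "?eq ([(s, True)] @ [(s, True), (s, False)]) ([(s, True)] @ [])"
      using word_eq.cancel[of _ s True] by (intro word_eq.append word_eq.refl) simp
    ultimately show ?thesis
      using False x word_eq.trans[OF word_eq.sym, of _ "[(s, True), (s, True), (s, False)]"] by simp
  qed (simp add: x word_eq.refl)
  then have "?eq ([x] @ w) ([(s, True)] @ map (\<lambda>x. (fst x, True)) w)"
    using Cons by (intro word_eq.append) auto
  then show ?case by (simp add: x)
qed

lemma word_eval_lists:
  "w \<in> lists (S \<times> UNIV) \<Longrightarrow> word_eval G w = ev (map fst w)"
  by (induction w) (auto simp: S_inv)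

lemma word_eval_closed: "w \<in> lists (S \<times> UNIV) \<Longrightarrow> word_eval G w \<in> carrier G"
  by (induction w) auto

lemma word_eval_append:
  "u \<in> lists (S \<times> UNIV) \<Longrightarrow> v \<in> lists (S \<times> UNIV) \<Longrightarrow>
    word_eval G (u @ v) = word_eval G u \<otimes> word_eval G v"
proof (induction u)
  case (Cons x u)
  then have "word_eval G u \<in> carrier G" "word_eval G v \<in> carrier G"
    using word_eval_closed by auto
  then show ?case using Cons by (auto simp: m_assoc)
qed (simp add: word_eval_closed)

text \<open>Derivations may pass through letters outside \<open>S\<close>; these are erased.\<close>

lemma word_eq_sound:
  "word_eq (coxeter_relators S cmat) u v \<Longrightarrow>
    word_eval G (filter (\<lambda>x. fst x \<in> S) u) = word_eval G (filter (\<lambda>x. fst x \<in> S) v)"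
proof (induction rule: word_eq.induct)
  case (append u u' v v')
  have "filter (\<lambda>x. fst x \<in> S) w \<in> lists (S \<times> UNIV)" for w :: "('a \<times> bool) list" by auto
  then show ?case using append by (simp add: word_eval_append)
next
  case (relator r)
  then obtain s t where r: "s \<in> S" "t \<in> S"
    "r = concat (replicate (cmat s t) [(s, True), (t, True)])"
    by (auto simp: coxeter_relators_def)
  have f: "filter (\<lambda>x. fst x \<in> S) r = r" "r \<in> lists (S \<times> UNIV)"
    using r by (auto simp: filter_id_conv split: if_splits)
  have "map fst r = concat (replicate (cmat s t) [s, t])"
    unfolding r(3) by (induction "cmat s t") (auto simp: map_concat)
  then have "word_eval G r = (s \<otimes> t) [^] cmat s t"
    using f r by (simp add: word_eval_lists ev_replicate)
  then show ?case using f r by (simp add: cmat_def)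
qed auto

theorem coxeter_system_cmat: "coxeter_system G S cmat"
proof -
  have "coxeter_matrix S cmat"
    unfolding coxeter_matrix_def
  proof (intro conjI ballI impI)
    fix s t assume st: "s \<in> S" "t \<in> S"
    show "cmat s s = 1" using st by (simp add: cmat_def S_involution)
    have "inv (s \<otimes> t) = t \<otimes> s" using st by (simp add: inv_mult_group S_inv)
    then show "cmat s t = cmat t s" using ord_inv[of "s \<otimes> t"] st by (simp add: cmat_def)
    assume "s \<noteq> t"
    then have "s \<otimes> t \<noteq> \<one>" using st inv_equality[of s t] S_inv[of t] by auto
    then show "cmat s t \<noteq> 1" using st ord_eq_1[of "s \<otimes> t"] by (simp add: cmat_def)
  qed
  moreover have "word_eval G w = \<one> \<longleftrightarrow> word_eq (coxeter_relators S cmat) w []"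
    if w: "w \<in> lists (S \<times> UNIV)" for w
  proof
    assume e: "word_eval G w = \<one>"
    have l: "map fst w \<in> lists S" using w by fastforce
    obtain v where v: "red v" "ev v = ev (map fst w)" "map fst w \<cong>\<^sub>S v"
      using weq_red[OF l] by blast
    have "v = []" using red_le[OF v(1), of "[]"] v e w by (simp add: word_eval_lists)
    then have "word_eq (coxeter_relators S cmat) (map (\<lambda>x. (fst x, True)) w) []"
      using v(3) by (simp add: weq_def comp_def)
    then show "word_eq (coxeter_relators S cmat) w []"
      using word_eq_unsign[OF w] word_eq.trans by blast
  next
    assume "word_eq (coxeter_relators S cmat) w []"
    from word_eq_sound[OF this] w have "word_eval G (filter (\<lambda>x. fst x \<in> S) w) = \<one>" by simp
    moreover have "filter (\<lambda>x. fst x \<in> S) w = w" using w by (intro filter_True) auto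
    ultimately show "word_eval G w = \<one>" by simp
  qed
  ultimately show ?thesis
    using S_carrier S_generate by (simp add: coxeter_system_def is_group)
qed

end

section \<open>Finite root systems\<close>

definition refl_along :: "('v::real_vector \<Rightarrow> 'v \<Rightarrow> real) \<Rightarrow> 'v \<Rightarrow> 'v \<Rightarrow> 'v" where
  "refl_along b a v = v - b a v *\<^sub>R a"

definition nonneg_span :: "'v::real_vector set \<Rightarrow> 'v set" where
  "nonneg_span D = {\<Sum>d\<in>D. c d *\<^sub>R d | c :: 'v \<Rightarrow> real. \<forall>d. 0 \<le> c d}"

lemma nonneg_spanI: "(\<And>d. 0 \<le> c d) \<Longrightarrow> (\<Sum>d\<in>D. c d *\<^sub>R d) \<in> nonneg_span D"
  unfolding nonneg_span_def by blast

lemma nonneg_spanE: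
  assumes "v \<in> nonneg_span D"
  obtains c where "\<And>d. (0 :: real) \<le> c d" "v = (\<Sum>d\<in>D. c d *\<^sub>R d)"
  using assms unfolding nonneg_span_def by blast

lemma nonneg_span_base: "finite D \<Longrightarrow> a \<in> D \<Longrightarrow> a \<in> nonneg_span D"
proof -
  assume "finite D" "a \<in> D"
  then have "(\<Sum>d\<in>D. (if d = a then 1 else 0 :: real) *\<^sub>R d) = a"
    by (simp add: if_distrib[of "\<lambda>c. c *\<^sub>R _"] sum.delta cong: if_cong)
  then show ?thesis using nonneg_spanI[of "\<lambda>d. if d = a then 1 else 0" D] by simp
qed

text \<open>Pairings of roots may be any reals, so that non-crystallographic systems such as
  \<open>H_3\<close> are included. The functional \<open>f\<close> vanishes at no root; its sign
  separates positive from negative roots.\<close>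

locale root_system =
  fixes b :: "'v::real_vector \<Rightarrow> 'v \<Rightarrow> real" and \<Phi> :: "'v set" and f :: "'v \<Rightarrow> real"
  assumes b_linear: "linear (b u)"
    and b_sym: "b u v = b v u"
    and finite_roots: "finite \<Phi>"
    and root_norm: "\<alpha> \<in> \<Phi> \<Longrightarrow> b \<alpha> \<alpha> = 2"
    and refl_root: "\<alpha> \<in> \<Phi> \<Longrightarrow> \<beta> \<in> \<Phi> \<Longrightarrow> refl_along b \<alpha> \<beta> \<in> \<Phi>"
    and f_linear: "linear f"
    and f_nonzero: "\<alpha> \<in> \<Phi> \<Longrightarrow> f \<alpha> \<noteq> 0"
begin

abbreviation refl :: "'v \<Rightarrow> 'v \<Rightarrow> 'v" where "refl \<equiv> refl_along b"

definition pos :: "'v set" where "pos = {\<alpha> \<in> \<Phi>. f \<alpha> > 0}"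

text \<open>Simple roots are found by economy: a smallest set of positive roots whose cone contains
  all of them. It exists because \<open>pos\<close> itself qualifies, and minimality yields
  \<open>simple_indep\<close>, which takes the place of linear independence.\<close>

definition simple :: "'v set" ("\<Delta>") where
  "\<Delta> = (ARG_MIN card D. D \<subseteq> pos \<and> pos \<subseteq> nonneg_span D)"

definition act :: "'v list \<Rightarrow> 'v \<Rightarrow> 'v" where "act as v = foldr refl as v"

lemma b_simps:
  "b u (v + w) = b u v + b u w" "b u (v - w) = b u v - b u w" "b u (c *\<^sub>R v) = c * b u v"
  "b (v + w) u = b v u + b w u" "b (v - w) u = b v u - b w u" "b (c *\<^sub>R v) u = c * b v u"
  "b u (- v) = - b u v" "b (- v) u = - b v u"
proof -
  show "b u (v + w) = b u v + b u w" "b u (v - w) = b u v - b u w" "b u (c *\<^sub>R v) = c * b u v"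
    "b u (- v) = - b u v" for u v w c
    using b_linear[of u] by (simp_all add: linear_add linear_diff linear_scale linear_neg)
  then show "b (v + w) u = b v u + b w u" "b (v - w) u = b v u - b w u"
    "b (c *\<^sub>R v) u = c * b v u" "b (- v) u = - b v u"
    by (simp_all only: b_sym[of _ u])
qed

lemmas f_simps = linear_add[OF f_linear] linear_diff[OF f_linear] linear_scale[OF f_linear]
  linear_neg[OF f_linear] linear_sum[OF f_linear]

lemma refl_linear: "linear (refl a)"
  by (rule linearI) (simp_all add: refl_along_def b_simps algebra_simps)

lemma refl_refl: "\<alpha> \<in> \<Phi> \<Longrightarrow> refl \<alpha> (refl \<alpha> v) = v"
  by (simp add: refl_along_def b_simps root_norm)

lemma refl_self: "\<alpha> \<in> \<Phi> \<Longrightarrow> refl \<alpha> \<alpha> = - \<alpha>"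
  by (simp add: refl_along_def root_norm scaleR_2)

lemma refl_isometry: "\<alpha> \<in> \<Phi> \<Longrightarrow> b (refl \<alpha> u) (refl \<alpha> v) = b u v"
  by (simp add: refl_along_def b_simps root_norm b_sym[of u \<alpha>])

lemma uminus_root: "\<alpha> \<in> \<Phi> \<Longrightarrow> - \<alpha> \<in> \<Phi>"
  using refl_root[of \<alpha> \<alpha>] by (simp add: refl_self)

lemma proportional_roots:
  assumes "\<alpha> \<in> \<Phi>" "c *\<^sub>R \<alpha> \<in> \<Phi>" shows "c = 1 \<or> c = -1"
proof -
  have "c * c * 2 = 2" using root_norm[OF assms(2)] root_norm[OF assms(1)] by (simp add: b_simps)
  then have "c * c = 1" by simp
  then show ?thesis by (simp add: square_eq_1_iff)
qed

lemma refl_eqD: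
  assumes "\<alpha> \<in> \<Phi>" "\<beta> \<in> \<Phi>" "refl \<alpha> = refl \<beta>" shows "\<beta> = \<alpha> \<or> \<beta> = - \<alpha>"
proof -
  have "- \<alpha> = \<alpha> - b \<beta> \<alpha> *\<^sub>R \<beta>"
    using refl_self[OF assms(1)] unfolding assms(3) by (simp add: refl_along_def)
  then have "2 *\<^sub>R \<alpha> = b \<beta> \<alpha> *\<^sub>R \<beta>" by (simp add: scaleR_2 algebra_simps)
  then have "\<alpha> = (b \<beta> \<alpha> / 2) *\<^sub>R \<beta>"
    by (metis divide_inverse_commute inverse_eq_divide real_vector.scale_scale scaleR_half_double scaleR_2)
  then show ?thesis using proportional_roots[of \<beta> "b \<beta> \<alpha> / 2"] assms by fastforce
qed

lemma posD: "\<alpha> \<in> pos \<Longrightarrow> \<alpha> \<in> \<Phi>" "\<alpha> \<in> pos \<Longrightarrow> f \<alpha> > 0"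
  by (auto simp: pos_def)

lemma root_cases: "\<alpha> \<in> \<Phi> \<Longrightarrow> \<alpha> \<in> pos \<or> - \<alpha> \<in> pos"
  using f_nonzero[of \<alpha>] uminus_root[of \<alpha>] by (auto simp: pos_def f_simps)

lemma finite_pos: "finite pos"
  using finite_roots by (simp add: pos_def)

lemma simple_props: "\<Delta> \<subseteq> pos" "pos \<subseteq> nonneg_span \<Delta>"
  and simple_min: "\<And>D. D \<subseteq> pos \<Longrightarrow> pos \<subseteq> nonneg_span D \<Longrightarrow> card \<Delta> \<le> card D"
proof -
  let ?P = "\<lambda>D. D \<subseteq> pos \<and> pos \<subseteq> nonneg_span D"
  have "?P pos" using nonneg_span_base[OF finite_pos] by blast
  from arg_min_nat_lemma[where P = ?P and m = card, OF this]
  show "\<Delta> \<subseteq> pos" "pos \<subseteq> nonneg_span \<Delta>"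
    "\<And>D. D \<subseteq> pos \<Longrightarrow> pos \<subseteq> nonneg_span D \<Longrightarrow> card \<Delta> \<le> card D"
    unfolding simple_def by blast+
qed

lemma finite_simple: "finite \<Delta>"
  using simple_props(1) finite_pos finite_subset by blast

lemma simple_root: "\<alpha> \<in> \<Delta> \<Longrightarrow> \<alpha> \<in> \<Phi>" and simple_pos: "\<alpha> \<in> \<Delta> \<Longrightarrow> f \<alpha> > 0"
  using simple_props(1) posD by blast+

lemma simple_indep:
  assumes a: "\<alpha> \<in> \<Delta>" shows "\<alpha> \<notin> nonneg_span (\<Delta> - {\<alpha>})"
proof
  assume "\<alpha> \<in> nonneg_span (\<Delta> - {\<alpha>})"
  then obtain d where d: "\<And>x. (0 :: real) \<le> d x" "\<alpha> = (\<Sum>x\<in>\<Delta> - {\<alpha>}. d x *\<^sub>R x)"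
    using nonneg_spanE by blast
  have "pos \<subseteq> nonneg_span (\<Delta> - {\<alpha>})"
  proof
    fix \<beta> assume "\<beta> \<in> pos"
    then obtain c where c: "\<And>x. (0 :: real) \<le> c x" "\<beta> = (\<Sum>x\<in>\<Delta>. c x *\<^sub>R x)"
      using simple_props(2) nonneg_spanE[of \<beta> \<Delta>] by blast
    have "\<beta> = c \<alpha> *\<^sub>R \<alpha> + (\<Sum>x\<in>\<Delta> - {\<alpha>}. c x *\<^sub>R x)"
      unfolding c(2) using a finite_simple by (simp add: sum.remove)
    also have "c \<alpha> *\<^sub>R \<alpha> = (\<Sum>x\<in>\<Delta> - {\<alpha>}. (c \<alpha> * d x) *\<^sub>R x)"
      by (subst (2) d(2)) (simp add: scaleR_sum_right)
    finally have "\<beta> = (\<Sum>x\<in>\<Delta> - {\<alpha>}. (c \<alpha> * d x + c x) *\<^sub>R x)"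
      by (simp add: sum.distrib scaleR_left_distrib)
    then show "\<beta> \<in> nonneg_span (\<Delta> - {\<alpha>})"
      using nonneg_spanI[of "\<lambda>x. c \<alpha> * d x + c x"] c(1) d(1) by simp
  qed
  then have "card \<Delta> \<le> card (\<Delta> - {\<alpha>})" using simple_min simple_props(1) by blast
  then show False using card_Diff1_less[OF finite_simple a] by simp
qed

text \<open>If the image were negative, \<open>\<beta> - refl \<alpha> \<beta>\<close>, a multiple
  of \<alpha>, would be a nonnegative combination of simple roots. Moving its \<alpha>-part to the
  other side puts \<alpha> into the cone of the remaining simple roots, against
  \<open>simple_indep\<close>.\<close>

lemma simple_refl_pos:
  assumes a: "\<alpha> \<in> \<Delta>" and \<beta>: "\<beta> \<in> pos" "\<beta> \<noteq> \<alpha>"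
  shows "refl \<alpha> \<beta> \<in> pos"
proof (rule ccontr)
  assume "refl \<alpha> \<beta> \<notin> pos"
  moreover have r: "refl \<alpha> \<beta> \<in> \<Phi>" using a \<beta> simple_root posD refl_root by blast
  ultimately have "- refl \<alpha> \<beta> \<in> pos" using root_cases by blast
  then obtain d where d: "\<And>x. (0 :: real) \<le> d x" "- refl \<alpha> \<beta> = (\<Sum>x\<in>\<Delta>. d x *\<^sub>R x)"
    using simple_props(2) nonneg_spanE[of "- refl \<alpha> \<beta>" \<Delta>] by blast
  obtain c where c: "\<And>x. (0 :: real) \<le> c x" "\<beta> = (\<Sum>x\<in>\<Delta>. c x *\<^sub>R x)"
    using \<beta> simple_props(2) nonneg_spanE[of \<beta> \<Delta>] by blast
  define T where "T = (\<Sum>x\<in>\<Delta> - {\<alpha>}. (c x + d x) *\<^sub>R x)"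
  define k where "k = b \<alpha> \<beta> - c \<alpha> - d \<alpha>"
  have "b \<alpha> \<beta> *\<^sub>R \<alpha> = \<beta> + (- refl \<alpha> \<beta>)" by (simp add: refl_along_def)
  also have "\<dots> = (\<Sum>x\<in>\<Delta>. (c x + d x) *\<^sub>R x)"
    unfolding d(2) by (subst c(2)) (simp add: sum.distrib scaleR_left_distrib)
  also have "\<dots> = (c \<alpha> + d \<alpha>) *\<^sub>R \<alpha> + T"
    unfolding T_def using a finite_simple by (simp add: sum.remove)
  finally have T: "T = k *\<^sub>R \<alpha>" by (simp add: k_def algebra_simps)
  \<comment> \<open>Otherwise \<beta> would be a nonnegative multiple of \<alpha>, hence \<alpha>
    itself. The nonzero coefficient makes \<open>f T\<close> positive, which forces
    \<open>k > 0\<close> and permits division by \<open>k\<close>.\<close>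
  have "\<exists>x\<in>\<Delta> - {\<alpha>}. c x \<noteq> 0"
  proof (rule ccontr)
    assume "\<not> ?thesis"
    then have "\<beta> = c \<alpha> *\<^sub>R \<alpha>"
      unfolding c(2) using a finite_simple by (simp add: sum.remove)
    moreover from this have "c \<alpha> = 1 \<or> c \<alpha> = -1"
      using proportional_roots[of \<alpha> "c \<alpha>"] a \<beta> simple_root posD by simp
    ultimately show False using c(1)[of \<alpha>] \<beta>(2) by auto
  qed
  then obtain x where x: "x \<in> \<Delta> - {\<alpha>}" "c x > 0" using c(1) by (metis order_le_less)
  have "0 < (\<Sum>x\<in>\<Delta> - {\<alpha>}. (c x + d x) * f x)"
  proof (rule sum_pos2[OF _ x(1)])
    show "0 < (c x + d x) * f x" using x d(1)[of x] simple_pos[of x] by simp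
    show "0 \<le> (c y + d y) * f y" if "y \<in> \<Delta> - {\<alpha>}" for y
      using that c(1)[of y] d(1)[of y] simple_pos[of y] by simp
  qed (use finite_simple in simp)
  also have "\<dots> = f T" by (simp add: T_def f_simps)
  finally have k: "k > 0" using simple_pos[OF a] by (simp add: T f_simps zero_less_mult_iff)
  have "\<alpha> = (1 / k) *\<^sub>R T" using k by (simp add: T)
  also have "\<dots> = (\<Sum>x\<in>\<Delta> - {\<alpha>}. ((c x + d x) / k) *\<^sub>R x)"
    by (simp add: T_def scaleR_sum_right)
  finally have "\<alpha> = (\<Sum>x\<in>\<Delta> - {\<alpha>}. ((c x + d x) / k) *\<^sub>R x)" .
  then have "\<alpha> \<in> nonneg_span (\<Delta> - {\<alpha>})"
    using nonneg_spanI[of "\<lambda>x. (c x + d x) / k" "\<Delta> - {\<alpha>}"] c(1) d(1) k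
    by (simp add: add_nonneg_nonneg)
  then show False using simple_indep a by blast
qed

lemma act_Nil [simp]: "act [] v = v" and act_Cons [simp]: "act (a # as) v = refl a (act as v)"
  by (simp_all add: act_def)

lemma act_append: "act (as @ bs) v = act as (act bs v)"
  by (induction as) auto

lemma act_linear: "linear (act as)"
proof (induction as)
  case Nil
  then show ?case by (simp add: linear_iff)
next
  case (Cons a as)
  show ?case using linear_compose[OF Cons refl_linear[of a]] by (simp add: comp_def)
qed

lemma act_isometry: "as \<in> lists \<Phi> \<Longrightarrow> b (act as u) (act as v) = b u v"
  by (induction as) (auto simp: refl_isometry)

lemma act_root: "as \<in> lists \<Phi> \<Longrightarrow> \<alpha> \<in> \<Phi> \<Longrightarrow> act as \<alpha> \<in> \<Phi>"
  by (induction as) (auto simp: refl_root)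

lemma act_rev: "as \<in> lists \<Phi> \<Longrightarrow> act (rev as) (act as v) = v"
  by (induction as arbitrary: v) (auto simp: act_append refl_refl)

lemma simple_lists: "as \<in> lists \<Delta> \<Longrightarrow> as \<in> lists \<Phi>"
  using simple_root by (auto simp: in_lists_conv_set)

lemma act_refl:
  "as \<in> lists \<Phi> \<Longrightarrow> act as (refl \<alpha> v) = refl (act as \<alpha>) (act as v)"
  by (simp add: refl_along_def linear_diff[OF act_linear] linear_scale[OF act_linear] act_isometry)

text \<open>Since \<open>b \<beta> \<beta> > 0\<close>, some simple root pairs positively with
  \<beta>, and reflecting in it lowers \<open>f\<close>. Values of \<open>f\<close> are real, so the
  induction counts the finitely many positive roots below \<beta>.\<close>

lemma pos_conj_simple:
  "\<beta> \<in> pos \<Longrightarrow> \<exists>as\<in>lists \<Delta>. \<exists>\<alpha>\<in>\<Delta>. \<beta> = act as \<alpha>"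
proof (induction "card {\<gamma> \<in> pos. f \<gamma> < f \<beta>}" arbitrary: \<beta> rule: less_induct)
  case less
  show ?case
  proof (cases "\<beta> \<in> \<Delta>")
    case True
    then show ?thesis by (intro bexI[of _ "[]"] bexI[of _ \<beta>]) auto
  next
    case False
    obtain c where c: "\<And>x. (0 :: real) \<le> c x" "\<beta> = (\<Sum>x\<in>\<Delta>. c x *\<^sub>R x)"
      using less.prems simple_props(2) nonneg_spanE[of \<beta> \<Delta>] by blast
    have "0 < b \<beta> \<beta>" using less.prems posD root_norm by simp
    also have "b \<beta> \<beta> = (\<Sum>x\<in>\<Delta>. c x * b \<beta> x)"
      by (subst (2) c(2)) (simp add: linear_sum[OF b_linear] b_simps)
    finally have "\<not> (\<forall>x\<in>\<Delta>. c x * b \<beta> x \<le> 0)" using sum_nonpos[of \<Delta> "\<lambda>x. c x * b \<beta> x"] by fastforce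
    then obtain \<alpha> where \<alpha>: "\<alpha> \<in> \<Delta>" "0 < c \<alpha> * b \<beta> \<alpha>" by force
    then have "b \<alpha> \<beta> > 0" using c(1)[of \<alpha>] b_sym[of \<alpha> \<beta>] by (simp add: zero_less_mult_iff)
    then have lt: "f (refl \<alpha> \<beta>) < f \<beta>"
      using simple_pos[OF \<alpha>(1)] by (simp add: refl_along_def f_simps)
    have p: "refl \<alpha> \<beta> \<in> pos" using simple_refl_pos[OF \<alpha>(1) less.prems] False \<alpha> by blast
    have "{\<gamma> \<in> pos. f \<gamma> < f (refl \<alpha> \<beta>)} \<subset> {\<gamma> \<in> pos. f \<gamma> < f \<beta>}" using lt p by auto
    then have "card {\<gamma> \<in> pos. f \<gamma> < f (refl \<alpha> \<beta>)} < card {\<gamma> \<in> pos. f \<gamma> < f \<beta>}"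
      using finite_pos by (intro psubset_card_mono) auto
    from less.hyps[OF this p] obtain as \<delta> where as: "as \<in> lists \<Delta>" "\<delta> \<in> \<Delta>" "refl \<alpha> \<beta> = act as \<delta>"
      by blast
    have "\<beta> = act (\<alpha> # as) \<delta>" using as(3) \<alpha> simple_root by (simp flip: as(3) add: refl_refl)
    then show ?thesis using as \<alpha> by (intro bexI[of _ "\<alpha> # as"] bexI[of _ \<delta>]) auto
  qed
qed

lemma root_conj_simple:
  assumes "\<beta> \<in> \<Phi>" shows "\<exists>as\<in>lists \<Delta>. \<exists>\<alpha>\<in>\<Delta>. \<beta> = act as \<alpha>"
proof (cases "\<beta> \<in> pos")
  case False
  then have "- \<beta> \<in> pos" using root_cases assms by blast
  then obtain as \<alpha> where as: "as \<in> lists \<Delta>" "\<alpha> \<in> \<Delta>" "- \<beta> = act as \<alpha>"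
    using pos_conj_simple by blast
  have "\<beta> = act (as @ [\<alpha>]) \<alpha>"
    using as simple_root by (simp add: act_append refl_self linear_neg[OF act_linear] flip: as(3))
  then show ?thesis using as by (intro bexI[of _ "as @ [\<alpha>]"] bexI[of _ \<alpha>]) auto
qed (simp add: pos_conj_simple)

text \<open>The reflection in \<open>w \<alpha>\<close> is the conjugate by \<open>w\<close> of the
  reflection in \<alpha>, and \<open>rev\<close> inverts a word of reflections.\<close>

lemma refl_eq_act:
  assumes "\<beta> \<in> \<Phi>" shows "\<exists>as\<in>lists \<Delta>. refl \<beta> = act as"
proof -
  obtain as \<alpha> where as: "as \<in> lists \<Delta>" "\<alpha> \<in> \<Delta>" "\<beta> = act as \<alpha>"
    using root_conj_simple assms by blast
  have "refl \<beta> v = act (as @ [\<alpha>] @ rev as) v" for v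
    using act_rev[of "rev as" v] act_refl[of as \<alpha> "act (rev as) v"] simple_lists[OF as(1)] as
    by (simp add: act_append in_lists_conv_set)
  then show ?thesis using as by (intro bexI[of _ "as @ [\<alpha>] @ rev as"]) auto
qed

text \<open>As the letters act from the right, the image of \<alpha> starts positive and ends
  negative. By \<open>simple_refl_pos\<close> the letter where the sign flips is the very root
  reached just before; by conjugation its reflection cancels against that in \<alpha>.\<close>

lemma act_deletion:
  assumes "as \<in> lists \<Delta>" "\<alpha> \<in> \<Delta>" "f (act as \<alpha>) < 0"
  shows "\<exists>i < length as. act as \<circ> refl \<alpha> = act (delete_at i as)"
  using assms
proof (induction as rule: list.induct)
  case Nil
  then show ?case using simple_pos[of \<alpha>] by simp
next
  case (Cons \<delta> as)
  have d: "\<delta> \<in> \<Delta>" "as \<in> lists \<Delta>" "as \<in> lists \<Phi>" using Cons.prems(1) simple_lists[of as] by simp_all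
  show ?case
  proof (cases "f (act as \<alpha>) < 0")
    case True
    then obtain i where i: "i < length as" "act as \<circ> refl \<alpha> = act (delete_at i as)"
      using Cons.IH[OF d(2) Cons.prems(2) True] by blast
    then have "act (\<delta> # as) \<circ> refl \<alpha> = act (delete_at (Suc i) (\<delta> # as))"
      by (auto simp: fun_eq_iff delete_at_def)
    moreover have "Suc i < length (\<delta> # as)" using i by simp
    ultimately show ?thesis by blast
  next
    case False
    have r: "act as \<alpha> \<in> \<Phi>" using act_root d simple_root Cons.prems by blast
    then have "act as \<alpha> \<in> pos" using False f_nonzero[OF r] by (auto simp: pos_def)
    then have "act as \<alpha> = \<delta>"
      using simple_refl_pos[OF d(1), of "act as \<alpha>"] Cons.prems(3) posD(2) by fastforce
    then have "act (\<delta> # as) \<circ> refl \<alpha> = act (delete_at 0 (\<delta> # as))"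
      using d simple_root by (auto simp: fun_eq_iff delete_at_def act_refl refl_refl)
    moreover have "0 < length (\<delta> # as)" by simp
    ultimately show ?thesis by blast
  qed
qed

lemma simple_refl_inj: "inj_on refl \<Delta>"
proof (rule inj_onI)
  fix \<alpha> \<beta> assume h: "\<alpha> \<in> \<Delta>" "\<beta> \<in> \<Delta>" "refl \<alpha> = refl \<beta>"
  then have "\<beta> = \<alpha> \<or> \<beta> = - \<alpha>" using refl_eqD simple_root by blast
  then show "\<alpha> = \<beta>" using simple_pos[OF h(1)] simple_pos[OF h(2)] by (auto simp: f_simps)
qed

text \<open>Commuting means that conjugation by the reflection in \<alpha> fixes the one in \<beta>,
  so \<open>refl \<alpha> \<beta>\<close> is \<beta> or its negative. The negative would make the
  two simple roots proportional.\<close>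

lemma commuting_orthogonal:
  assumes "\<alpha> \<in> \<Delta>" "\<beta> \<in> \<Delta>" "\<alpha> \<noteq> \<beta>"
    and comm: "\<And>v. refl \<alpha> (refl \<beta> (refl \<alpha> (refl \<beta> v))) = v"
  shows "b \<alpha> \<beta> = 0"
proof -
  have r: "\<alpha> \<in> \<Phi>" "\<beta> \<in> \<Phi>" using assms simple_root by auto
  let ?\<gamma> = "refl \<alpha> \<beta>"
  have "refl ?\<gamma> v = refl \<beta> v" for v
  proof -
    have "refl ?\<gamma> v = refl \<alpha> (refl \<beta> (refl \<alpha> v))"
      using act_refl[of "[\<alpha>]" \<beta> "refl \<alpha> v"] r by (simp add: refl_refl)
    also have "\<dots> = refl \<alpha> (refl \<beta> (refl \<alpha> (refl \<beta> (refl \<beta> v))))" using r by (simp add: refl_refl)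
    finally show ?thesis using comm by simp
  qed
  then have "?\<gamma> = \<beta> \<or> ?\<gamma> = - \<beta>"
    using refl_eqD[of \<beta> ?\<gamma>] r refl_root by (auto simp: fun_eq_iff)
  then show ?thesis
  proof
    assume "?\<gamma> = \<beta>"
    then have "b \<alpha> \<beta> *\<^sub>R \<alpha> = 0" by (simp add: refl_along_def)
    then show ?thesis using simple_pos[OF assms(1)] by (auto simp: f_simps linear_0[OF f_linear])
  next
    assume "?\<gamma> = - \<beta>"
    then have "\<beta> + \<beta> = b \<alpha> \<beta> *\<^sub>R \<alpha>" by (simp add: refl_along_def algebra_simps)
    then have "(1/2) *\<^sub>R (\<beta> + \<beta>) = (b \<alpha> \<beta> / 2) *\<^sub>R \<alpha>" by simp
    then have "\<beta> = (b \<alpha> \<beta> / 2) *\<^sub>R \<alpha>" by (simp add: scaleR_half_double)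
    then have "\<beta> = \<alpha> \<or> \<beta> = - \<alpha>" using proportional_roots[of \<alpha> "b \<alpha> \<beta> / 2"] r by fastforce
    then show ?thesis using assms simple_pos[OF assms(1)] simple_pos[OF assms(2)]
      by (auto simp: f_simps)
  qed
qed

end

section \<open>Reflection groups of finite root systems\<close>

locale root_system_group = root_system b \<Phi> f + group G
  for b :: "'v::real_vector \<Rightarrow> 'v \<Rightarrow> real" and \<Phi> f and G :: "('v \<Rightarrow> 'v) monoid" (structure) +
  fixes R :: "('v \<Rightarrow> 'v) set"
  assumes mult_comp: "mult G = (\<circ>)" and one_id: "one G = id"
    and refl_carrier: "\<alpha> \<in> \<Phi> \<Longrightarrow> refl_along b \<alpha> \<in> carrier G"
    and R_refl: "R \<subseteq> refl_along b ` \<Phi>"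
    and R_generate: "generate G R = carrier G"
begin

lemma word_prod_refl: "word_prod G (map refl as) = act as"
  by (induction as) (auto simp: word_prod_def mult_comp one_id)

lemma act_generate: "as \<in> lists \<Delta> \<Longrightarrow> act as \<in> generate G (refl ` \<Delta>)"
proof (induction as)
  case Nil
  then show ?case using generate.one[of G] by (simp add: one_id id_def act_def)
next
  case (Cons a as)
  have "act (a # as) = refl a \<otimes> act as" by (auto simp: mult_comp)
  moreover have "refl a \<in> generate G (refl ` \<Delta>)" using Cons by (auto intro: generate.incl)
  ultimately show ?case using Cons generate.eng[of "refl a" G "refl ` \<Delta>" "act as"] by auto
qed

text \<open>Each reflection in a root is a word in simple ones, so the given generating set
  \<open>R\<close> may be exchanged for the simple reflections.\<close>

lemma generate_simple: "generate G (refl ` \<Delta>) = carrier G"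
proof
  show "generate G (refl ` \<Delta>) \<subseteq> carrier G"
    using generate_incl[of "refl ` \<Delta>"] refl_carrier simple_root by blast
  have "R \<subseteq> generate G (refl ` \<Delta>)"
    using R_refl refl_eq_act act_generate by fastforce
  moreover have "subgroup (generate G (refl ` \<Delta>)) G"
    using generate_is_subgroup[of "refl ` \<Delta>"] refl_carrier simple_root by blast
  ultimately show "carrier G \<subseteq> generate G (refl ` \<Delta>)"
    using generate_subgroup_incl R_generate by blast
qed

lemma inv_refl: "\<alpha> \<in> \<Phi> \<Longrightarrow> inv (refl \<alpha>) = refl \<alpha>"
  by (rule inv_equality) (auto simp: refl_carrier mult_comp one_id fun_eq_iff refl_refl)

lemma carrier_act:
  assumes "g \<in> carrier G" shows "\<exists>as\<in>lists \<Delta>. g = act as"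
proof -
  have "g \<in> generate G (refl ` \<Delta>)" using assms generate_simple by simp
  then show ?thesis
  proof (induction rule: generate.induct)
    case one
    then show ?case by (intro bexI[of _ "[]"]) (auto simp: one_id)
  next
    case (incl h)
    then obtain \<alpha> where "\<alpha> \<in> \<Delta>" "h = refl \<alpha>" by blast
    then show ?case by (intro bexI[of _ "[\<alpha>]"]) auto
  next
    case (inv h)
    then obtain \<alpha> where "\<alpha> \<in> \<Delta>" "h = refl \<alpha>" by blast
    then show ?case by (intro bexI[of _ "[\<alpha>]"]) (auto simp: inv_refl simple_root)
  next
    case (eng h1 h2)
    then obtain as bs where "as \<in> lists \<Delta>" "bs \<in> lists \<Delta>" "h1 = act as" "h2 = act bs" by blast
    then show ?case
      by (intro bexI[of _ "as @ bs"]) (auto simp: mult_comp act_append)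
  qed
qed

definition desc :: "('v \<Rightarrow> 'v) \<Rightarrow> ('v \<Rightarrow> 'v) \<Rightarrow> bool" where
  "desc g s \<longleftrightarrow> (\<exists>\<alpha>\<in>\<Delta>. s = refl \<alpha> \<and> f (g \<alpha>) < 0)"

sublocale descent_group G "refl ` \<Delta>" desc
proof unfold_locales
  show "refl ` \<Delta> \<subseteq> carrier G" using refl_carrier simple_root by blast
  show "generate G (refl ` \<Delta>) = carrier G" by (rule generate_simple)
  show "s \<otimes> s = \<one>" if "s \<in> refl ` \<Delta>" for s
    using that simple_root by (auto simp: mult_comp one_id fun_eq_iff refl_refl)
  show "desc g s \<or> desc (g \<otimes> s) s" if "g \<in> carrier G" "s \<in> refl ` \<Delta>" for g s
  proof -
    obtain as where as: "as \<in> lists \<Delta>" "g = act as" using carrier_act \<open>g \<in> carrier G\<close> by blast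
    obtain \<alpha> where \<alpha>: "\<alpha> \<in> \<Delta>" "s = refl \<alpha>" using \<open>s \<in> refl ` \<Delta>\<close> by blast
    have "f (g \<alpha>) \<noteq> 0"
      using act_root[OF simple_lists[OF as(1)] simple_root[OF \<alpha>(1)]] f_nonzero as(2) by simp
    moreover have "f ((g \<otimes> s) \<alpha>) = - f (g \<alpha>)"
      using refl_self[OF simple_root[OF \<alpha>(1)]]
      by (simp add: mult_comp \<alpha>(2) as(2) linear_neg[OF act_linear] f_simps)
    ultimately show ?thesis unfolding desc_def using \<alpha> by (metis neg_less_0_iff_less linorder_less_linear)
  qed
  show "\<exists>i<length w. word_prod G w \<otimes> s = word_prod G (delete_at i w)"
    if w: "w \<in> lists (refl ` \<Delta>)" and d: "desc (word_prod G w) s" for w s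
  proof -
    obtain as where as: "as \<in> lists \<Delta>" "w = map refl as"
      using w by (auto simp: lists_image)
    obtain \<alpha> where \<alpha>: "\<alpha> \<in> \<Delta>" "s = refl \<alpha>" "f (act as \<alpha>) < 0"
      using d by (auto simp: desc_def as(2) word_prod_refl)
    obtain i where i: "i < length as" "act as \<circ> refl \<alpha> = act (delete_at i as)"
      using act_deletion[OF as(1) \<alpha>(1,3)] by blast
    have "delete_at i w = map refl (delete_at i as)"
      by (simp add: delete_at_def as(2) take_map drop_map)
    then show ?thesis using i as \<alpha> by (intro exI[of _ i]) (simp add: mult_comp word_prod_refl)
  qed
qed

lemma nonadjacent_orthogonal:
  assumes "\<alpha> \<in> \<Delta>" "\<beta> \<in> \<Delta>" "\<alpha> \<noteq> \<beta>" "(refl \<alpha>, refl \<beta>) \<notin> coxeter_graph (refl ` \<Delta>) cmat"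
  shows "b \<alpha> \<beta> = 0"
proof -
  have "refl \<alpha> \<noteq> refl \<beta>" using assms simple_refl_inj by (auto dest: inj_onD)
  then have "cmat (refl \<alpha>) (refl \<beta>) = 2" using assms by (auto simp: coxeter_graph_def)
  moreover have c: "refl \<alpha> \<otimes> refl \<beta> \<in> carrier G"
    using assms by (intro m_closed refl_carrier simple_root)
  ultimately have "(refl \<alpha> \<otimes> refl \<beta>) [^] (2::nat) = \<one>"
    using pow_eq_id[OF c, of 2] by (simp add: cmat_def)
  then have "(refl \<alpha> \<otimes> refl \<beta>) \<otimes> (refl \<alpha> \<otimes> refl \<beta>) = \<one>"
    using c by (simp add: numeral_2_eq_2)
  then show ?thesis
    using assms(1-3) by (intro commuting_orthogonal) (auto simp: mult_comp one_id fun_eq_iff)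
qed

text \<open>A disconnected Coxeter graph splits the simple roots into orthogonal families
  \<open>A\<close> and \<open>B\<close>. Reflections of one family fix the span of the other, so
  every root lies in one of the two spans. By \<open>irred\<close> all roots lie in one, where a
  simple root of the other family would be orthogonal to itself.\<close>

theorem coxeter_irreducible_cmat:
  assumes ne: "\<Phi> \<noteq> {}"
    and irred: "\<And>U V. subspace U \<Longrightarrow> subspace V \<Longrightarrow> (\<And>u v. u \<in> U \<Longrightarrow> v \<in> V \<Longrightarrow> b u v = 0) \<Longrightarrow>
      \<Phi> \<subseteq> U \<union> V \<Longrightarrow> \<Phi> \<subseteq> U \<or> \<Phi> \<subseteq> V"
  shows "coxeter_irreducible (refl ` \<Delta>) cmat"
  unfolding coxeter_irreducible_def
proof (intro conjI ballI)
  show "refl ` \<Delta> \<noteq> {}" using ne root_conj_simple by blast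
  let ?E = "coxeter_graph (refl ` \<Delta>) cmat"
  fix s t assume st: "s \<in> refl ` \<Delta>" "t \<in> refl ` \<Delta>"
  show "(s, t) \<in> ?E\<^sup>*"
  proof (rule ccontr)
    assume nc: "(s, t) \<notin> ?E\<^sup>*"
    define A where "A = {\<alpha> \<in> \<Delta>. (s, refl \<alpha>) \<in> ?E\<^sup>*}"
    define B where "B = \<Delta> - A"
    have orth: "b \<alpha> \<beta> = 0" if "\<alpha> \<in> A" "\<beta> \<in> B" for \<alpha> \<beta>
    proof (rule nonadjacent_orthogonal)
      show "(refl \<alpha>, refl \<beta>) \<notin> ?E"
        using that rtrancl_into_rtrancl[of s "refl \<alpha>" ?E "refl \<beta>"] by (auto simp: A_def B_def)
    qed (use that in \<open>auto simp: A_def B_def\<close>)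
    have span_orth: "b u v = 0" if u: "u \<in> span A" and v: "v \<in> span B" for u v
    proof -
      have 1: "b \<alpha> v = 0" if "\<alpha> \<in> A" for \<alpha>
        using v
      proof (induction rule: span_induct)
        case base
        then show ?case by (simp add: subspace_def b_simps linear_0[OF b_linear])
      qed (use orth that in auto)
      have "b v u = 0"
        using u
      proof (induction rule: span_induct)
        case base
        then show ?case by (simp add: subspace_def b_simps linear_0[OF b_linear])
      qed (use 1 b_sym in auto)
      then show ?thesis using b_sym by simp
    qed
    have "act as \<alpha> \<in> span A \<union> span B" if "as \<in> lists \<Delta>" "\<alpha> \<in> \<Delta>" for as \<alpha>
      using that(1)
    proof (induction as)
      case Nil
      then show ?case using that(2) span_base[of \<alpha> A] span_base[of \<alpha> B] by (auto simp: B_def)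
    next
      case (Cons \<delta> as)
      then consider "act as \<alpha> \<in> span A" "\<delta> \<in> A" | "act as \<alpha> \<in> span B" "\<delta> \<in> B"
        | "act as \<alpha> \<in> span A" "\<delta> \<in> B" | "act as \<alpha> \<in> span B" "\<delta> \<in> A"
        by (auto simp: B_def)
      then show ?case
      proof cases
        case 3
        then have "b \<delta> (act as \<alpha>) = 0" using span_orth b_sym span_base by metis
        then show ?thesis using 3 by (simp add: refl_along_def)
      next
        case 4
        then have "b \<delta> (act as \<alpha>) = 0" using span_orth span_base by metis
        then show ?thesis using 4 by (simp add: refl_along_def)
      qed (simp_all add: refl_along_def span_diff span_scale span_base)
    qed
    then have "\<Phi> \<subseteq> span A \<union> span B" using root_conj_simple by (metis subsetI)
    then have "\<Phi> \<subseteq> span A \<or> \<Phi> \<subseteq> span B" using irred[of "span A" "span B"] span_orth by simp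
    then have "A = {} \<or> B = {}"
    proof (elim disjE)
      assume h: "\<Phi> \<subseteq> span A"
      have "False" if "\<beta> \<in> B" for \<beta>
        using that h simple_root[of \<beta>] span_orth[of \<beta> \<beta>] span_base[of \<beta> B] root_norm[of \<beta>]
        by (auto simp: B_def)
      then show ?thesis by blast
    next
      assume h: "\<Phi> \<subseteq> span B"
      have "False" if "\<alpha> \<in> A" for \<alpha>
        using that h simple_root[of \<alpha>] span_orth[of \<alpha> \<alpha>] span_base[of \<alpha> A] root_norm[of \<alpha>]
        by (auto simp: A_def)
      then show ?thesis by blast
    qed
    moreover have "A \<noteq> {}" using st by (auto simp: A_def)
    moreover have "B \<noteq> {}" using st nc by (auto simp: A_def B_def)
    ultimately show False by blast
  qed
qed

end

section \<open>Orbits in the cube\<close>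

text \<open>The Fricke polynomial: for \<open>A\<close>, \<open>B\<close> in \<open>SL_2\<close>
  with traces of \<open>A\<close>, \<open>B\<close> and \<open>A B\<close> as coordinates, its value
  minus 2 is the trace of the commutator.\<close>

definition fricke :: "triple \<Rightarrow> real" where
  "fricke = (\<lambda>(x1, x2, x3). x1\<^sup>2 + x2\<^sup>2 + x3\<^sup>2 - x1 * x2 * x3)"

definition cube :: "triple set" where
  "cube = {-2..2} \<times> {-2..2} \<times> {-2..2}"

lemma fricke_beta: "fricke (beta g x) = fricke x"
  by (cases g; cases x) (simp_all add: fricke_def power2_eq_square algebra_simps)

lemma fricke_beta_inv: "fricke (beta_inv g x) = fricke x"
  by (metis fricke_beta beta_beta_inv(1))

lemma fricke_word_act: "fricke (word_act w x) = fricke x"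
  by (induction w) (auto simp: fricke_beta fricke_beta_inv)

lemma continuous_on_beta: "continuous_on A (beta g)"
  by (cases g) (simp_all add: case_prod_beta continuous_intros)

lemma continuous_on_beta_inv: "continuous_on A (beta_inv g)"
  by (cases g) (simp_all add: case_prod_beta continuous_intros)

text \<open>\<open>c - a * b\<close> and its analogues are the second roots, in one variable, of the
  equation fixing \<open>fricke\<close> (Vieta). Squared, the hypotheses read
  \<open>(a * b)^2 \<le> 2 * a * b * c\<close> and so on. So the product is nonnegative, and if it
  is nonzero, absolute values may replace the coordinates.\<close>

lemma fricke_le_4_of_maximal:
  fixes a b c :: real
  assumes "\<bar>a\<bar> \<le> 2" "\<bar>b\<bar> \<le> 2" "\<bar>c\<bar> \<le> 2"
    and c: "\<bar>c - a * b\<bar> \<le> \<bar>c\<bar>" and a: "\<bar>a - b * c\<bar> \<le> \<bar>a\<bar>" and b: "\<bar>b - a * c\<bar> \<le> \<bar>b\<bar>"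
  shows "fricke (a, b, c) \<le> 4"
proof -
  have sq: "a\<^sup>2 \<le> 4" "b\<^sup>2 \<le> 4" "c\<^sup>2 \<le> 4"
    using assms(1-3) abs_le_square_iff[of a 2] abs_le_square_iff[of b 2] abs_le_square_iff[of c 2]
    by simp_all
  define p where "p = a * b * c"
  have h: "(a * b)\<^sup>2 \<le> 2 * p" "(b * c)\<^sup>2 \<le> 2 * p" "(a * c)\<^sup>2 \<le> 2 * p"
    using abs_le_square_iff[of "c - a * b" c] abs_le_square_iff[of "a - b * c" a]
      abs_le_square_iff[of "b - a * c" b] a b c
    by (simp_all add: p_def power2_eq_square algebra_simps)
  show ?thesis
  proof (cases "p = 0")
    case True
    then have "a * b = 0" "b * c = 0" "a * c = 0" using h by simp_all
    then show ?thesis using sq by (auto simp: fricke_def)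
  next
    case False
    have main: "x\<^sup>2 + y\<^sup>2 + z\<^sup>2 - x * y * z \<le> 4"
      if "(x * y)\<^sup>2 \<le> 2 * (x * y * z)" "(x * z)\<^sup>2 \<le> 2 * (x * y * z)" "y\<^sup>2 \<le> x\<^sup>2" "x\<^sup>2 \<le> 4"
        "x * y * z \<noteq> 0" for x y z :: real
    proof -
      have nz: "x \<noteq> 0" "y \<noteq> 0" "z \<noteq> 0" using that by auto
      have pos: "x * y * z > 0" using that(1) nz zero_le_power2[of "x * y"] that(5) by linarith
      define X Y Z where "X = \<bar>x\<bar>" "Y = \<bar>y\<bar>" "Z = \<bar>z\<bar>"
      have XYZ: "X > 0" "Y > 0" "Z > 0" using nz by (simp_all add: X_Y_Z_def)
      have eq: "x * y * z = X * Y * Z" using pos by (simp add: X_Y_Z_def flip: abs_mult)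
      have sqs: "x\<^sup>2 = X\<^sup>2" "y\<^sup>2 = Y\<^sup>2" "z\<^sup>2 = Z\<^sup>2" by (simp_all add: X_Y_Z_def)
      have "(X * Y) * (X * Y) \<le> (X * Y) * (2 * Z)"
        using that(1) unfolding eq power_mult_distrib sqs by (simp add: power2_eq_square algebra_simps)
      then have Z1: "X * Y \<le> 2 * Z" using XYZ by simp
      have "(X * Z) * (X * Z) \<le> (X * Z) * (2 * Y)"
        using that(2) unfolding eq power_mult_distrib sqs by (simp add: power2_eq_square algebra_simps)
      then have Z2: "X * Z \<le> 2 * Y" using XYZ by simp
      have le: "Y\<^sup>2 \<le> X\<^sup>2" "X\<^sup>2 \<le> 4" using that sqs by simp_all
      \<comment> \<open>As a function of \<open>Z\<close> the polynomial increases on \<open>X Y / 2 \<le> Z \<le> 2 Y / X\<close>.\<close>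
      have "(2 * Y - X * Z) * (2 * Y + X * Z - X\<^sup>2 * Y) \<ge> 0"
      proof (rule mult_nonneg_nonneg)
        have "X * (X * Y) \<le> X * (2 * Z)" using Z1 XYZ by simp
        moreover have "X * (2 * Z) \<le> 2 * Y + X * Z" using Z2 by (simp add: algebra_simps)
        ultimately show "0 \<le> 2 * Y + X * Z - X\<^sup>2 * Y" by (simp add: power2_eq_square mult.assoc)
      qed (use Z2 in simp)
      \<comment> \<open>At the end \<open>Z = 2 * Y / X\<close> of that interval,
        \<open>X^2 * (4 - fricke (X, Y, Z))\<close> is exactly this product; this is why
        \<open>X\<close> has to be the larger of \<open>X\<close> and \<open>Y\<close>.\<close>
      moreover have "(4 - X\<^sup>2) * (X\<^sup>2 - Y\<^sup>2) \<ge> 0" using le by simp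
      ultimately have "0 \<le> X\<^sup>2 * (4 - (X\<^sup>2 + Y\<^sup>2 + Z\<^sup>2 - X * Y * Z))"
        by (simp add: power2_eq_square algebra_simps)
      then have "X\<^sup>2 + Y\<^sup>2 + Z\<^sup>2 - X * Y * Z \<le> 4"
        using XYZ by (simp add: zero_le_mult_iff)
      then show ?thesis unfolding eq sqs .
    qed
    have "b\<^sup>2 \<le> a\<^sup>2 \<or> a\<^sup>2 \<le> b\<^sup>2" by linarith
    then show ?thesis
    proof
      assume "b\<^sup>2 \<le> a\<^sup>2"
      then show ?thesis using main[of a b c] h sq False by (simp add: p_def fricke_def)
    next
      assume "a\<^sup>2 \<le> b\<^sup>2"
      then show ?thesis using main[of b a c] h sq False
        by (simp add: p_def fricke_def mult_ac add_ac)
    qed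
  qed
qed

text \<open>A point of the orbit closure at which \<open>\<bar>x\<^sub>1\<bar> + \<bar>x\<^sub>2\<bar> + \<bar>x\<^sub>3\<bar>\<close> is maximal satisfies the
  hypotheses of the previous lemma.\<close>

lemma fricke_le_4:
  assumes bd: "\<And>w. word_act w x \<in> cube"
  shows "fricke x \<le> 4"
proof -
  define Orb where "Orb = range (\<lambda>w. word_act w x)"
  define K where "K = closure Orb"
  have cl: "closed cube" by (simp add: cube_def closed_Times)
  have sub: "K \<subseteq> cube" unfolding K_def by (rule closure_minimal[OF _ cl]) (auto simp: Orb_def bd)
  have "compact cube" by (simp add: cube_def compact_Times)
  then have comp: "compact K" using compact_Int_closed[of cube K] sub by (simp add: K_def Int_absorb1)
  have ne: "K \<noteq> {}" by (simp add: K_def Orb_def)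
  have inv: "beta g y \<in> K" "beta_inv g y \<in> K" if "y \<in> K" for g y
  proof -
    have "beta g ` Orb \<subseteq> Orb"
      using rangeI[of "\<lambda>w. word_act w x" "(g, True) # _"] by (auto simp: Orb_def)
    then have "beta g ` closure Orb \<subseteq> closure Orb"
      using closure_subset[of Orb] by (intro image_closure_subset continuous_on_beta) auto
    moreover have "beta_inv g ` Orb \<subseteq> Orb"
      using rangeI[of "\<lambda>w. word_act w x" "(g, False) # _"] by (auto simp: Orb_def)
    then have "beta_inv g ` closure Orb \<subseteq> closure Orb"
      using closure_subset[of Orb] by (intro image_closure_subset continuous_on_beta_inv) auto
    ultimately show "beta g y \<in> K" "beta_inv g y \<in> K" using that by (auto simp: K_def)
  qed
  have fr: "fricke y = fricke x" if "y \<in> K" for y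
  proof -
    have "continuous_on UNIV fricke"
      by (simp add: fricke_def case_prod_beta continuous_intros)
    then have "closed (fricke -` {fricke x})" by (simp add: closed_vimage)
    then have "K \<subseteq> fricke -` {fricke x}"
      unfolding K_def by (rule closure_minimal[rotated]) (auto simp: Orb_def fricke_word_act)
    then show ?thesis using that by auto
  qed
  let ?h = "\<lambda>y :: triple. \<bar>fst y\<bar> + \<bar>fst (snd y)\<bar> + \<bar>snd (snd y)\<bar>"
  have "continuous_on K ?h" by (intro continuous_intros)
  from continuous_attains_sup[OF comp ne this] obtain y where
    y: "y \<in> K" "\<And>z. z \<in> K \<Longrightarrow> ?h z \<le> ?h y" by blast
  obtain a b c where abc: "y = (a, b, c)" by (cases y)
  have "fricke (a, b, c) \<le> 4"
  proof (rule fricke_le_4_of_maximal)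
    show "\<bar>a\<bar> \<le> 2" "\<bar>b\<bar> \<le> 2" "\<bar>c\<bar> \<le> 2" using subsetD[OF sub y(1)] by (auto simp: abc cube_def)
    \<comment> \<open>Each of the three moves changes one absolute value and permutes the other two,
      so maximality of the sum compares that value alone. The flip of \<open>b\<close> comes from
      the inverse of \<open>Beta1\<close>.\<close>
    show "\<bar>c - a * b\<bar> \<le> \<bar>c\<bar>" using y(2)[OF inv(1)[OF y(1), of Beta1]] by (simp add: abc)
    show "\<bar>a - b * c\<bar> \<le> \<bar>a\<bar>" using y(2)[OF inv(1)[OF y(1), of Beta2]] by (simp add: abc)
    show "\<bar>b - a * c\<bar> \<le> \<bar>b\<bar>" using y(2)[OF inv(2)[OF y(1), of Beta1]] by (simp add: abc)
  qed
  then show ?thesis using fr[OF y(1)] abc by simp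
qed

section \<open>Positive definiteness of the form\<close>

lemma bform_expand:
  "bform (x1, x2, x3) v w =
    2 * v$1 * w$1 + 2 * v$2 * w$2 + 2 * v$3 * w$3 + x1 * (v$1 * w$2 + v$2 * w$1)
    + x2 * (v$2 * w$3 + v$3 * w$2) + x3 * (v$1 * w$3 + v$3 * w$1)"
  by (simp add: bform_def gram_def sum_3 algebra_simps)

text \<open>Lagrange's completion of squares: 2, \<open>k\<close> and \<open>D / 2\<close> are the
  leading principal minors of the Gram matrix.\<close>

lemma bform_pos:
  assumes x: "x \<in> cube" "fricke x < 4" and v: "v \<noteq> 0"
  shows "bform x v v > 0"
proof -
  obtain a b c where abc: "x = (a, b, c)" by (cases x)
  obtain p q r where v123: "v$1 = p" "v$2 = q" "v$3 = r" by blast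
  have Q: "a\<^sup>2 + b\<^sup>2 + c\<^sup>2 - a * b * c < 4" using x by (simp add: abc fricke_def)
  define D where "D = 4 * (4 - (a\<^sup>2 + b\<^sup>2 + c\<^sup>2 - a * b * c))"
  define k where "k = 4 - a\<^sup>2"
  have D: "D > 0" using Q by (simp add: D_def)
  have "a\<^sup>2 \<le> 4" using x abs_le_square_iff[of a 2] by (simp add: abc cube_def abs_le_iff)
  \<comment> \<open>For \<open>a = 2\<close> or \<open>a = -2\<close>, \<open>fricke x\<close> would
    be \<open>4 + (b - c)^2\<close> or \<open>4 + (b + c)^2\<close>.\<close>
  moreover have "a\<^sup>2 \<noteq> 4"
  proof
    assume "a\<^sup>2 = 4"
    then have "a = 2 \<or> a = -2" using power2_eq_iff[of a 2] by simp
    moreover have "0 \<le> (b - c)\<^sup>2" "0 \<le> (b + c)\<^sup>2" by simp_all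
    ultimately show False using Q by (auto simp: power2_eq_square algebra_simps)
  qed
  ultimately have k: "k > 0" by (simp add: k_def)
  let ?A = "2 * p + a * q + c * r" and ?B = "k * q + (2 * b - a * c) * r"
  have id: "2 * k * bform x v v = k * ?A\<^sup>2 + ?B\<^sup>2 + D * r\<^sup>2"
    by (simp add: abc bform_expand v123 D_def k_def power2_eq_square algebra_simps)
  have "k * ?A\<^sup>2 + ?B\<^sup>2 + D * r\<^sup>2 > 0"
  proof (rule ccontr)
    assume n: "\<not> ?thesis"
    have 0: "0 \<le> k * ?A\<^sup>2" "0 \<le> ?B\<^sup>2" "0 \<le> D * r\<^sup>2" using k D by simp_all
    then have "D * r\<^sup>2 = 0" "?B\<^sup>2 = 0" "k * ?A\<^sup>2 = 0" using n by linarith+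
    then have "r = 0" "q = 0" "p = 0" using k D by auto
    then show False using v v123 by (simp add: vec_eq_iff forall_3)
  qed
  then show ?thesis using id k by (metis mult_pos_pos zero_less_mult_pos zero_less_numeral)
qed

lemma bform_linear: "linear (bform x u)"
  by (rule linearI) (simp_all add: bform_add_right bform_scaleR_right)

lemma bform_bounded:
  assumes "x \<in> cube" "fricke x < 4"
  shows "\<exists>B. \<forall>v. bform x v v = 2 \<longrightarrow> norm v \<le> B"
proof -
  obtain a b c where abc: "x = (a, b, c)" by (cases x)
  have cont: "continuous_on (sphere 0 1) (\<lambda>v. bform x v v)"
    unfolding abc bform_expand by (intro continuous_intros)
  have "compact (sphere (0 :: real^3) 1)" "sphere (0 :: real^3) 1 \<noteq> {}" by auto
  from continuous_attains_inf[OF this cont] obtain u where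
    u: "norm u = 1" "\<And>v. norm v = 1 \<Longrightarrow> bform x u u \<le> bform x v v" by auto
  define m where "m = bform x u u"
  have m: "m > 0" unfolding m_def using u by (intro bform_pos[OF assms]) auto
  have "norm v \<le> sqrt (2 / m)" if "bform x v v = 2" for v
  proof -
    have "v \<noteq> 0" using that by (auto simp: bform_def)
    then have "m \<le> bform x (v /\<^sub>R norm v) (v /\<^sub>R norm v)"
      using u(2)[of "v /\<^sub>R norm v"] by (simp add: m_def)
    also have "\<dots> = 2 / (norm v)\<^sup>2"
      using that bform_sym[of x "inverse (norm v) *\<^sub>R v" v]
      by (simp add: bform_scaleR_right power2_eq_square divide_inverse)
    finally have "(norm v)\<^sup>2 \<le> 2 / m" using m \<open>v \<noteq> 0\<close> by (simp add: field_simps)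
    then show ?thesis by (rule real_le_rsqrt)
  qed
  then show ?thesis by blast
qed

section \<open>Algebraic integers with bounded conjugates\<close>

abbreviation cpoly :: "rat poly \<Rightarrow> complex poly" where "cpoly \<equiv> map_poly of_rat"

lemma coeff_cpoly [simp]: "poly.coeff (cpoly p) i = of_rat (poly.coeff p i)"
  by (simp add: coeff_map_poly)

lemma cpoly_add: "cpoly (p + q) = cpoly p + cpoly q"
  and cpoly_diff: "cpoly (p - q) = cpoly p - cpoly q"
  and cpoly_mult: "cpoly (p * q) = cpoly p * cpoly q"
  and cpoly_smult: "cpoly (Polynomial.smult c p) = Polynomial.smult (of_rat c) (cpoly p)"
  by (rule poly_eqI; simp add: of_rat_add of_rat_diff coeff_mult of_rat_sum of_rat_mult)+

lemma cpoly_sum: "cpoly (\<Sum>i\<in>A. p i) = (\<Sum>i\<in>A. cpoly (p i))"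
  by (induction A rule: infinite_finite_induct) (auto simp: cpoly_add)

lemma cpoly_monom: "cpoly (Polynomial.monom c k) = Polynomial.monom (of_rat c) k"
  by (rule poly_eqI) (simp add: coeff_monom)

lemma degree_cpoly: "degree (cpoly p) = degree p"
  by (rule degree_map_poly) simp

lemma cpoly_dvd_root: "p dvd q \<Longrightarrow> poly (cpoly p) z = 0 \<Longrightarrow> poly (cpoly q) z = 0"
  by (auto simp: dvd_def cpoly_mult)

text \<open>Stands in for a Galois automorphism: the value of a rational polynomial at
  \<open>z\<close> depends only on its value at \<zeta>, so sending \<zeta> to \<open>z\<close> is a
  ring isomorphism of the generated rational algebras.\<close>

definition conjugate :: "complex \<Rightarrow> complex \<Rightarrow> bool" where
  "conjugate \<zeta> z \<longleftrightarrow> (\<forall>p. poly (cpoly p) \<zeta> = 0 \<longleftrightarrow> poly (cpoly p) z = 0)"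

lemma min_rat_poly_ex:
  assumes "q \<noteq> 0" "poly (cpoly q) \<zeta> = 0"
  obtains P where "P \<noteq> 0" "\<And>p. poly (cpoly p) \<zeta> = 0 \<longleftrightarrow> P dvd p"
proof -
  let ?R = "\<lambda>p. p \<noteq> 0 \<and> poly (cpoly p) \<zeta> = 0"
  obtain P where P: "?R P" "\<And>p. ?R p \<Longrightarrow> degree P \<le> degree p"
    using ex_has_least_nat[of ?R q degree] assms by blast
  have "P dvd p" if "poly (cpoly p) \<zeta> = 0" for p
  proof (rule ccontr)
    assume "\<not> P dvd p"
    then have nz: "p mod P \<noteq> 0" by (simp add: dvd_eq_mod_eq_0)
    have "cpoly p = cpoly (p div P) * cpoly P + cpoly (p mod P)"
      by (simp flip: cpoly_mult cpoly_add)
    then have "poly (cpoly (p mod P)) \<zeta> = 0" using that P(1) by simp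
    then have "degree P \<le> degree (p mod P)" using P(2) nz by blast
    then show False using degree_mod_less[of P p] P(1) nz by simp
  qed
  then show thesis using that[of P] P(1) cpoly_dvd_root[of P] by blast
qed

text \<open>Irreducibility of \<open>P\<close> in disguise. The minimal polynomial \<open>P'\<close>
  of \<open>z\<close> divides \<open>P\<close>; were it nonzero at \<zeta>, the cofactor would
  vanish there, be a multiple of \<open>P\<close>, and make \<open>P'\<close> a unit.\<close>

lemma root_min_poly_conjugate:
  assumes P: "P \<noteq> 0" "\<And>p. poly (cpoly p) \<zeta> = 0 \<longleftrightarrow> P dvd p" and z: "poly (cpoly P) z = 0"
  shows "conjugate \<zeta> z"
proof -
  obtain P' where P': "P' \<noteq> 0" "\<And>p. poly (cpoly p) z = 0 \<longleftrightarrow> P' dvd p"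
    using min_rat_poly_ex[OF P(1) z] by blast
  then obtain C where C: "P = P' * C" using z by (auto simp: dvd_def)
  have "poly (cpoly P') \<zeta> = 0"
  proof (rule ccontr)
    assume "poly (cpoly P') \<zeta> \<noteq> 0"
    moreover have "poly (cpoly P) \<zeta> = 0" using P(2) by simp
    ultimately have "P dvd C" using P(2) by (simp add: C cpoly_mult)
    then obtain E where "C = P * E" by (auto simp: dvd_def)
    then have "P * (P' * E) = P * 1" using C by (metis mult.assoc mult.commute mult_1_right)
    then have "P' * E = 1" using P(1) by (metis mult_cancel_left)
    then have "P' dvd 1" by (metis dvd_triv_left)
    then have "poly (cpoly 1) z = 0" using P'(2) by blast
    then show False by simp
  qed
  then have "P dvd P'" using P(2) by blast
  moreover have "P' dvd P" using C by simp
  ultimately show ?thesis unfolding conjugate_def using P(2) P'(2) dvd_trans by blast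
qed

lemma cpoly_unity: "poly (cpoly (Polynomial.monom 1 n - 1)) z = z ^ n - 1"
  by (simp add: cpoly_diff cpoly_monom poly_monom)

lemma unity_poly_nonzero: "n > 0 \<Longrightarrow> Polynomial.monom 1 n - 1 \<noteq> (0 :: rat poly)"
  by (metis degree_1 degree_monom_eq eq_iff_diff_eq_0 less_numeral_extra(3) zero_neq_one)

lemma conjugate_unity: "conjugate \<zeta> z \<Longrightarrow> \<zeta> ^ n = 1 \<Longrightarrow> z ^ n = 1"
  unfolding conjugate_def by (metis cpoly_unity eq_iff_diff_eq_0)

lemma conjugate_self: "conjugate z z"
  by (simp add: conjugate_def)

text \<open>\<open>x ^ n - 1\<close> shares no root with its derivative
  \<open>n * x ^ (n - 1)\<close>, so each divisor splits into distinct linear factors over the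
  complex numbers.\<close>

lemma card_roots_divisor_unity:
  assumes n: "n > 0" and P: "P dvd Polynomial.monom 1 n - 1"
  shows "card {z. poly (cpoly P) z = 0} = degree P"
proof -
  obtain C where C: "Polynomial.monom 1 n - 1 = P * C" using P by (auto simp: dvd_def)
  have e: "cpoly P * cpoly C = Polynomial.monom 1 n - 1"
    unfolding cpoly_mult[symmetric] C[symmetric] by (simp add: cpoly_diff cpoly_monom)
  have "\<not> (poly (cpoly P) a = 0 \<and> poly (pderiv (cpoly P)) a = 0)" for a
  proof
    assume a: "poly (cpoly P) a = 0 \<and> poly (pderiv (cpoly P)) a = 0"
    have "poly (pderiv (Polynomial.monom 1 n - 1)) a = 0" "poly (Polynomial.monom 1 n - 1) a = 0"
      using a by (simp_all flip: e add: pderiv_mult)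
    then have "of_nat n * a ^ (n - 1) = 0" "a ^ n = 1"
      by (simp_all add: pderiv_diff pderiv_monom poly_monom)
    then show False using n by (auto simp: power_0_left)
  qed
  then have "rsquarefree (cpoly P)" by (simp add: rsquarefree_roots)
  from complex_poly_decompose_rsquarefree[OF this]
  have "degree (cpoly P) = degree (Polynomial.smult (lead_coeff (cpoly P)) (\<Prod>z | poly (cpoly P) z = 0. [:- z, 1:]))"
    by simp
  also have "\<dots> = card {z. poly (cpoly P) z = 0}"
  proof -
    have "P \<noteq> 0" using P unity_poly_nonzero[OF n] by auto
    then have "lead_coeff (cpoly P) \<noteq> 0" by (simp add: degree_cpoly)
    then show ?thesis by (simp add: degree_prod_sum_eq)
  qed
  finally show ?thesis by (simp add: degree_cpoly)
qed

text \<open>Lagrange interpolation at \<open>W\<close> with basis polynomials \<open>L w\<close>: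
  the coefficients of \<open>q\<close> are linear combinations of its values, with weights
  independent of \<open>q\<close>.\<close>

lemma coeff_bound_from_values:
  fixes W :: "complex set"
  assumes W: "finite W"
  shows "\<exists>C. \<forall>q. degree q < card W \<longrightarrow> (\<forall>w\<in>W. norm (poly q w) \<le> B) \<longrightarrow> (\<forall>i. norm (poly.coeff q i) \<le> C)"
proof -
  define L where "L w = Polynomial.smult (inverse (\<Prod>y\<in>W - {w}. (w - y))) (\<Prod>y\<in>W - {w}. [:- y, 1:])" for w
  have deg: "degree (L w) < card W" if "w \<in> W" for w
  proof -
    have "degree (L w) \<le> card (W - {w})"
      unfolding L_def by (rule order.trans[OF degree_smult_le]) (simp add: degree_prod_sum_eq)
    then show ?thesis using card_Diff1_less[OF W that] by simp
  qed
  have val: "poly (L w) y = (if y = w then 1 else 0)" if "w \<in> W" "y \<in> W" for w y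
  proof (cases "y = w")
    case True
    have "(\<Prod>y\<in>W - {w}. w - y) \<noteq> 0" using W by (simp add: prod_zero_iff)
    moreover have "(\<Prod>y\<in>W - {w}. - y + w) = (\<Prod>y\<in>W - {w}. w - y)"
      by (rule prod.cong) simp_all
    ultimately show ?thesis using True by (simp add: L_def poly_prod)
  next
    case False
    have "(\<Prod>x\<in>W - {w}. y - x) = 0" using W False that by (intro prod_zero) auto
    moreover have "(\<Prod>x\<in>W - {w}. - x + y) = (\<Prod>x\<in>W - {w}. y - x)"
      by (rule prod.cong) simp_all
    ultimately show ?thesis using False by (simp add: L_def poly_prod)
  qed
  define M where "M = (\<Sum>i<card W. \<Sum>w\<in>W. norm (poly.coeff (L w) i))"
  have "norm (poly.coeff q i) \<le> \<bar>B\<bar> * M"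
    if q: "degree q < card W" "\<forall>w\<in>W. norm (poly q w) \<le> B" for q i
  proof (cases "i < card W")
    case True
    have "q = (\<Sum>w\<in>W. Polynomial.smult (poly q w) (L w))"
    proof (rule poly_eqI_degree[where A = W])
      show "poly q y = poly (\<Sum>w\<in>W. Polynomial.smult (poly q w) (L w)) y" if "y \<in> W" for y
      proof -
        have "poly (\<Sum>w\<in>W. Polynomial.smult (poly q w) (L w)) y = (\<Sum>w\<in>W. poly q w * (if y = w then 1 else 0))"
          using that val by (simp add: poly_sum)
        also have "\<dots> = poly q y" using W that by (simp add: if_distrib sum.delta cong: if_cong)
        finally show ?thesis by simp
      qed
      show "degree (\<Sum>w\<in>W. Polynomial.smult (poly q w) (L w)) < card W"
        using q(1) deg by (intro degree_sum_less) (auto intro: le_less_trans[OF degree_smult_le])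
    qed (use q in simp)
    then have "poly.coeff q i = (\<Sum>w\<in>W. poly q w * poly.coeff (L w) i)"
      by (metis (no_types, lifting) coeff_smult coeff_sum sum.cong)
    also have "norm \<dots> \<le> (\<Sum>w\<in>W. \<bar>B\<bar> * norm (poly.coeff (L w) i))"
    proof (rule sum_norm_le)
      fix w assume "w \<in> W"
      then have "norm (poly q w) \<le> \<bar>B\<bar>" using q(2) by fastforce
      then show "norm (poly q w * poly.coeff (L w) i) \<le> \<bar>B\<bar> * norm (poly.coeff (L w) i)"
        by (simp add: norm_mult mult_right_mono)
    qed
    also have "\<dots> \<le> \<bar>B\<bar> * M"
      unfolding sum_distrib_left[symmetric] M_def using True
      by (intro mult_left_mono member_le_sum[of i]) (auto intro: sum_nonneg)
    finally show ?thesis .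
  next
    case False
    then have "poly.coeff q i = 0" using q(1) by (simp add: coeff_eq_0)
    then show ?thesis by (simp add: M_def sum_nonneg)
  qed
  then show ?thesis by blast
qed

lemma common_denominator:
  "finite A \<Longrightarrow> \<exists>D :: nat. D > 0 \<and> (\<forall>a\<in>A. of_nat D * a \<in> (\<int> :: rat set))"
proof (induction A rule: finite_induct)
  case empty
  then show ?case by (intro exI[of _ 1]) simp
next
  case (insert a A)
  then obtain D where D: "D > 0" "\<forall>a\<in>A. of_nat D * a \<in> (\<int> :: rat set)" by blast
  obtain p q where pq: "a = of_int p / of_int q" "q > 0"
    by (metis quotient_of_div quotient_of_denom_pos surj_pair)
  have "of_nat (D * nat q) * a = of_nat D * of_int p" using pq by simp
  moreover have "of_nat (D * nat q) * x = of_int q * (of_nat D * x)" for x :: rat using pq by simp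
  ultimately have "\<forall>x\<in>insert a A. of_nat (D * nat q) * x \<in> \<int>"
    using D(2) by (metis Ints_mult Ints_of_int Ints_of_nat insert_iff)
  then show ?case using D(1) pq(2) by (intro exI[of _ "D * nat q"]) simp
qed

lemma finite_bounded_denominator:
  assumes "D > 0" shows "finite {a :: rat. of_nat D * a \<in> \<int> \<and> \<bar>a\<bar> \<le> C}"
proof -
  have "{a :: rat. of_nat D * a \<in> \<int> \<and> \<bar>a\<bar> \<le> C} \<subseteq>
      (\<lambda>k. of_int k / of_nat D) ` {- \<lceil>of_nat D * C\<rceil> .. \<lceil>of_nat D * C\<rceil>}"
  proof
    fix a :: rat assume "a \<in> {a. of_nat D * a \<in> \<int> \<and> \<bar>a\<bar> \<le> C}"
    then obtain k where k: "of_nat D * a = of_int k" "\<bar>a\<bar> \<le> C" by (auto elim: Ints_cases)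
    have "of_nat D * \<bar>a\<bar> \<le> of_nat D * C" using k(2) by (simp add: mult_left_mono)
    then have "\<bar>of_int k :: rat\<bar> \<le> of_nat D * C" by (simp flip: k(1) add: abs_mult)
    then have "\<bar>k\<bar> \<le> \<lceil>of_nat D * C\<rceil>" by linarith
    moreover have "a = of_int k / of_nat D" using k assms by (simp add: field_simps)
    ultimately show "a \<in> (\<lambda>k. of_int k / of_nat D) ` {- \<lceil>of_nat D * C\<rceil> .. \<lceil>of_nat D * C\<rceil>}"
      by (intro image_eqI) auto
  qed
  then show ?thesis by (rule finite_subset) simp
qed

abbreviation integral_poly :: "rat poly \<Rightarrow> bool" where
  "integral_poly p \<equiv> \<forall>i. poly.coeff p i \<in> \<int>"

lemma norm_of_rat: "norm (of_rat r :: complex) = \<bar>of_rat r\<bar>"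
proof (cases r)
  case (Fract a b)
  then show ?thesis by (simp add: of_rat_rat norm_divide)
qed

text \<open>The value at \<zeta> depends only on the remainder \<open>q\<close> modulo the minimal
  polynomial. The values of \<open>q\<close> at the \<open>degree P\<close> conjugates are bounded,
  hence so are its coefficients; these also have a common denominator, so finitely many
  \<open>q\<close> remain.\<close>

theorem finite_bounded_conjugates:
  assumes n: "n > 0" and \<zeta>: "\<zeta> ^ n = 1"
  shows "finite {poly (cpoly p) \<zeta> | p. integral_poly p \<and> (\<forall>z. conjugate \<zeta> z \<longrightarrow> norm (poly (cpoly p) z) \<le> B)}"
    (is "finite ?S")
proof -
  have u: "poly (cpoly (Polynomial.monom 1 n - 1)) \<zeta> = 0" using \<zeta> cpoly_unity by simp
  obtain P where P: "P \<noteq> 0" "\<And>p. poly (cpoly p) \<zeta> = 0 \<longleftrightarrow> P dvd p"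
    using min_rat_poly_ex[OF unity_poly_nonzero[OF n] u] by blast
  define W where "W = {z. poly (cpoly P) z = 0}"
  have cW: "card W = degree P"
    unfolding W_def using card_roots_divisor_unity[OF n] P(2) u by blast
  have "cpoly P \<noteq> 0" using P(1) by (metis coeff_0 coeff_cpoly leading_coeff_0_iff of_rat_eq_0_iff)
  then have fW: "finite W" unfolding W_def by (rule poly_roots_finite)
  have conjW: "conjugate \<zeta> w" if "w \<in> W" for w
    using root_min_poly_conjugate[OF P] that by (simp add: W_def)
  have Pz: "poly (cpoly P) z = 0" if "conjugate \<zeta> z" for z
    using that P(2)[of P] by (simp add: conjugate_def)
  have "degree P \<noteq> 0"
  proof
    assume "degree P = 0"
    then have "W = {}" using cW fW by simp
    then show False using Pz[OF conjugate_self] by (auto simp: W_def)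
  qed
  then have dP: "degree P > 0" by simp
  \<comment> \<open>Exponents matter only modulo \<open>n\<close>, so the remainders of the powers
    below \<open>n\<close> serve for all powers and one \<open>D\<close> works for every integral
    \<open>p\<close>.\<close>
  obtain D where D: "D > 0"
    "\<forall>a\<in>(\<lambda>(k, i). poly.coeff (Polynomial.monom 1 k mod P) i) ` ({..<n} \<times> {..<degree P}). of_nat D * a \<in> (\<int> :: rat set)"
    using common_denominator[of "(\<lambda>(k, i). poly.coeff (Polynomial.monom 1 k mod P) i) ` ({..<n} \<times> {..<degree P})"]
    by auto
  obtain C where C: "\<And>q i. degree q < card W \<Longrightarrow> (\<forall>w\<in>W. norm (poly q w) \<le> B) \<Longrightarrow> norm (poly.coeff q i) \<le> C"
    using coeff_bound_from_values[OF fW, of B] by blast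
  obtain C' :: rat where C': "of_rat C' > C" using of_rat_dense[of C "C + 1"] by auto
  define V where "V = {a :: rat. of_nat D * a \<in> \<int> \<and> \<bar>a\<bar> \<le> C'}"
  define T where "T = Poly ` {xs. set xs \<subseteq> V \<and> length xs \<le> degree P}"
  have "finite T" unfolding T_def V_def
    using finite_lists_length_le[OF finite_bounded_denominator[OF D(1)]] by blast
  moreover have "?S \<subseteq> (\<lambda>q. poly (cpoly q) \<zeta>) ` T"
  proof
    fix s assume "s \<in> ?S"
    then obtain p where p: "integral_poly p" "s = poly (cpoly p) \<zeta>"
      "\<And>z. conjugate \<zeta> z \<Longrightarrow> norm (poly (cpoly p) z) \<le> B" by blast
    define m where "m k = Polynomial.monom 1 (k mod n) mod P" for k
    define q where "q = (\<Sum>k\<le>degree p. Polynomial.smult (poly.coeff p k) (m k))"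
    have md: "degree (m k) < degree P" for k
      using degree_mod_less[OF P(1), of "Polynomial.monom 1 (k mod n)"] dP by (auto simp: m_def)
    have qd: "degree q < degree P"
      unfolding q_def using md dP by (intro degree_sum_less) (auto intro: le_less_trans[OF degree_smult_le])
    have qval: "poly (cpoly q) z = poly (cpoly p) z" if z: "conjugate \<zeta> z" for z
    proof -
      have "poly (cpoly (m k)) z = z ^ k" for k
      proof -
        have "cpoly (Polynomial.monom 1 (k mod n)) = cpoly (Polynomial.monom 1 (k mod n) div P) * cpoly P + cpoly (m k)"
          by (simp add: m_def flip: cpoly_mult cpoly_add)
        then have "poly (cpoly (m k)) z = z ^ (k mod n)"
          using Pz[OF z] by (metis (no_types, lifting) add.left_neutral cpoly_monom mult_zero_right
            of_rat_1 poly_add poly_monom poly_mult mult_1)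
        moreover have "z ^ k = z ^ (n * (k div n) + k mod n)" by simp
        then have "z ^ k = z ^ (k mod n)"
          using conjugate_unity[OF z \<zeta>] by (simp only: power_add power_mult power_one mult_1)
        ultimately show ?thesis by simp
      qed
      then have "poly (cpoly q) z = (\<Sum>k\<le>degree p. of_rat (poly.coeff p k) * z ^ k)"
        by (simp add: q_def cpoly_sum cpoly_smult poly_sum)
      also have "\<dots> = poly (cpoly p) z" by (simp add: poly_altdef degree_cpoly)
      finally show ?thesis .
    qed
    have "poly.coeff q i \<in> V" if "i < degree P" for i
    proof -
      have "of_nat D * poly.coeff (m k) i \<in> \<int>" for k
        using D(2) that n by (auto simp: m_def)
      then have "poly.coeff p k * (of_nat D * poly.coeff (m k) i) \<in> \<int>" for k
        using p(1) Ints_mult by blast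
      then have "(\<Sum>k\<le>degree p. poly.coeff p k * (of_nat D * poly.coeff (m k) i)) \<in> \<int>"
        by (intro Ints_sum) simp
      moreover have "of_nat D * poly.coeff q i = (\<Sum>k\<le>degree p. poly.coeff p k * (of_nat D * poly.coeff (m k) i))"
        by (simp add: q_def coeff_sum sum_distrib_left mult_ac)
      ultimately have "of_nat D * poly.coeff q i \<in> \<int>" by simp
      moreover have "norm (poly.coeff (cpoly q) i) \<le> C"
        using C[of "cpoly q" i] qd cW qval conjW p(3) by (simp add: degree_cpoly)
      then have "(of_rat \<bar>poly.coeff q i\<bar> :: real) < of_rat C'" using C' by (simp add: norm_of_rat)
      then have "\<bar>poly.coeff q i\<bar> \<le> C'" by (simp add: of_rat_less)
      ultimately show ?thesis by (simp add: V_def)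
    qed
    then have "set (coeffs q) \<subseteq> V"
      using qd by (auto simp: coeffs_def in_set_conv_nth nth_append split: if_splits)
    moreover have "length (coeffs q) \<le> degree P" using qd by (simp add: length_coeffs coeffs_def)
    ultimately have "q \<in> T" unfolding T_def by (intro image_eqI[of _ _ "coeffs q"]) auto
    moreover have "s = poly (cpoly q) \<zeta>" using p(2) qval[OF conjugate_self] by simp
    ultimately show "s \<in> (\<lambda>q. poly (cpoly q) \<zeta>) ` T" by blast
  qed
  ultimately show ?thesis using finite_subset by blast
qed

text \<open>Such an \<open>h\<close> records a real element \<open>h \<zeta>\<close> of
  \<open>Z[\<zeta>]\<close> together with its conjugates \<open>h z\<close>. Requiring real values
  keeps the conjugate triples and their forms over the reals.\<close>

definition integral_fun :: "nat \<Rightarrow> (complex \<Rightarrow> real) \<Rightarrow> bool" where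
  "integral_fun n h \<longleftrightarrow>
    (\<exists>p. integral_poly p \<and> (\<forall>z. z ^ n = 1 \<longrightarrow> complex_of_real (h z) = poly (cpoly p) z))"

lemma integral_fun_of_int: "integral_fun n (\<lambda>z. of_int c)"
  unfolding integral_fun_def
  by (intro exI[of _ "[:of_int c:]"]) (auto simp: coeff_pCons map_poly_pCons split: nat.split)

lemma integral_fun_consts: "integral_fun n (\<lambda>z. 0)" "integral_fun n (\<lambda>z. 1)"
    "integral_fun n (\<lambda>z. numeral k)"
  using integral_fun_of_int[of n 0] integral_fun_of_int[of n 1] integral_fun_of_int[of n "numeral k"]
  by simp_all

lemma integral_fun_add:
  assumes "integral_fun n g" "integral_fun n h" shows "integral_fun n (\<lambda>z. g z + h z)"
proof -
  obtain p q where "integral_poly p" "integral_poly q"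
    "\<And>z. z ^ n = 1 \<Longrightarrow> complex_of_real (g z) = poly (cpoly p) z"
    "\<And>z. z ^ n = 1 \<Longrightarrow> complex_of_real (h z) = poly (cpoly q) z"
    using assms unfolding integral_fun_def by blast
  then show ?thesis unfolding integral_fun_def
    by (intro exI[of _ "p + q"]) (auto simp: cpoly_add)
qed

lemma integral_fun_mult:
  assumes "integral_fun n g" "integral_fun n h" shows "integral_fun n (\<lambda>z. g z * h z)"
proof -
  obtain p q where "integral_poly p" "integral_poly q"
    "\<And>z. z ^ n = 1 \<Longrightarrow> complex_of_real (g z) = poly (cpoly p) z"
    "\<And>z. z ^ n = 1 \<Longrightarrow> complex_of_real (h z) = poly (cpoly q) z"
    using assms unfolding integral_fun_def by blast
  then show ?thesis unfolding integral_fun_def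
    by (intro exI[of _ "p * q"]) (auto simp: cpoly_mult coeff_mult intro!: Ints_sum Ints_mult)
qed

lemma integral_fun_uminus: "integral_fun n h \<Longrightarrow> integral_fun n (\<lambda>z. - h z)"
  using integral_fun_mult[OF integral_fun_of_int[of n "-1"], of h] by simp

lemma integral_fun_diff:
  "integral_fun n g \<Longrightarrow> integral_fun n h \<Longrightarrow> integral_fun n (\<lambda>z. g z - h z)"
  using integral_fun_add[OF _ integral_fun_uminus, of n g h] by simp

lemmas integral_fun_intros = integral_fun_consts integral_fun_add integral_fun_mult
  integral_fun_uminus integral_fun_diff

lemma integral_fun_Re_power:
  assumes "n > 0" shows "integral_fun n (\<lambda>z. - 2 * Re (z ^ k))"
proof -
  \<comment> \<open>On the unit circle the complex conjugate is the inverse, here the power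
    \<open>n - 1\<close>, so \<open>2 * Re (z ^ k)\<close> is a sum of two powers.\<close>
  let ?p = "- (Polynomial.monom 1 k + Polynomial.monom 1 ((n - 1) * k)) :: rat poly"
  have "complex_of_real (- 2 * Re (z ^ k)) = poly (cpoly ?p) z" if z: "z ^ n = 1" for z
  proof -
    have "norm z = 1" using power_eq_1_iff[OF z] assms by simp
    then have "z * cnj z = 1" by (simp add: complex_norm_square[symmetric])
    moreover have "z * z ^ (n - 1) = 1" using z assms by (simp add: power_eq_if)
    ultimately have "cnj z = z ^ (n - 1)" by (metis mult.assoc mult.commute mult_1)
    then have "cnj (z ^ k) = z ^ ((n - 1) * k)" by (simp add: power_mult)
    moreover have "complex_of_real (- 2 * Re (z ^ k)) = - (z ^ k + cnj (z ^ k))"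
      by (subst complex_add_cnj) simp
    moreover have "cpoly ?p = - (Polynomial.monom 1 k + Polynomial.monom 1 ((n - 1) * k))"
      by (rule poly_eqI) (simp add: of_rat_minus of_rat_add)
    ultimately show ?thesis by (simp add: poly_monom)
  qed
  moreover have "integral_poly ?p" by (auto intro!: Ints_add Ints_minus)
  ultimately show ?thesis unfolding integral_fun_def by blast
qed

lemma integral_fun_conjugate_eq_0:
  assumes "integral_fun n h" "\<zeta> ^ n = 1" "conjugate \<zeta> z"
  shows "h \<zeta> = 0 \<longleftrightarrow> h z = 0"
  using assms conjugate_unity[OF assms(3,2)] unfolding integral_fun_def conjugate_def
  by (metis of_real_eq_0_iff)

lemma finite_integral_fun_values:
  assumes n: "n > 0" and \<zeta>: "\<zeta> ^ n = 1"
  shows "finite {h \<zeta> | h. integral_fun n h \<and> (\<forall>z. conjugate \<zeta> z \<longrightarrow> \<bar>h z\<bar> \<le> B)}" (is "finite ?S")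
proof -
  let ?T = "{poly (cpoly p) \<zeta> | p. integral_poly p \<and> (\<forall>z. conjugate \<zeta> z \<longrightarrow> norm (poly (cpoly p) z) \<le> B)}"
  have "complex_of_real ` ?S \<subseteq> ?T"
  proof (clarify)
    fix h assume h: "integral_fun n h" "\<forall>z. conjugate \<zeta> z \<longrightarrow> \<bar>h z\<bar> \<le> B"
    then obtain p where p: "integral_poly p" "\<And>z. z ^ n = 1 \<Longrightarrow> complex_of_real (h z) = poly (cpoly p) z"
      unfolding integral_fun_def by blast
    have "norm (poly (cpoly p) z) \<le> B" if "conjugate \<zeta> z" for z
      using h(2) that by (simp flip: p(2)[OF conjugate_unity[OF that \<zeta>]])
    then show "\<exists>p. complex_of_real (h \<zeta>) = poly (cpoly p) \<zeta> \<and> integral_poly p \<and>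
        (\<forall>z. conjugate \<zeta> z \<longrightarrow> norm (poly (cpoly p) z) \<le> B)"
      using p \<zeta> by blast
  qed
  then have "finite (complex_of_real ` ?S)"
    using finite_bounded_conjugates[OF n \<zeta>] finite_subset by blast
  then show ?thesis by (rule finite_imageD) (simp add: inj_on_def)
qed

section \<open>Rescaled Chebyshev polynomials and rational angles\<close>

fun cheb :: "nat \<Rightarrow> real \<Rightarrow> real" where
  "cheb 0 a = 2"
| "cheb (Suc 0) a = a"
| "cheb (Suc (Suc k)) a = a * cheb (Suc k) a - cheb k a"

lemma cheb_cos: "cheb k (2 * cos t) = 2 * cos (real k * t)"
proof (induction k "2 * cos t" rule: cheb.induct)
  case (3 k)
  have "cos (real (Suc (Suc k)) * t) = 2 * cos t * cos (real (Suc k) * t) - cos (real k * t)"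
    using cos_add[of "real (Suc k) * t" t] cos_diff[of "real (Suc k) * t" t]
    by (simp add: algebra_simps)
  then show ?case using 3 by (simp add: algebra_simps)
qed simp_all

text \<open>Outside \<open>[-2, 2]\<close> the recursion makes absolute values grow strictly from
  the initial value 2, so 2 is not attained again.\<close>

lemma cheb_gt:
  assumes "\<bar>a\<bar> > 2"
  shows "\<bar>cheb k a\<bar> \<ge> 2 \<and> \<bar>cheb (Suc k) a\<bar> > \<bar>cheb k a\<bar>"
proof (induction k)
  case 0
  then show ?case using assms by simp
next
  case (Suc k)
  have "2 * \<bar>cheb (Suc k) a\<bar> \<le> \<bar>a\<bar> * \<bar>cheb (Suc k) a\<bar>" using assms by (intro mult_right_mono) auto
  then have "2 * \<bar>cheb (Suc k) a\<bar> - \<bar>cheb k a\<bar> \<le> \<bar>cheb (Suc (Suc k)) a\<bar>"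
    using abs_triangle_ineq2[of "a * cheb (Suc k) a" "cheb k a"] by (simp add: abs_mult)
  then show ?case using Suc by linarith
qed

lemma cheb_eq_2:
  assumes "k > 0" "cheb k a = 2" shows "\<bar>a\<bar> \<le> 2"
  using cheb_gt[of a "k - 1"] assms by (cases k) force+

lemma integral_fun_cheb: "integral_fun n h \<Longrightarrow> integral_fun n (\<lambda>z. cheb k (h z))"
  by (induction k "0 :: real" rule: cheb.induct) (auto intro: integral_fun_intros)

lemma cheb_rational:
  assumes "r \<in> \<rat>" shows "\<exists>k>0. cheb k (- 2 * cos (pi * r)) = 2"
proof -
  obtain p q where pq: "r = of_int p / of_int q" "q > 0"
    using assms by (metis Rats_cases')
  \<comment> \<open>The shift of \<open>r\<close> by 1 absorbs the minus sign, and the index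
    \<open>2 * q\<close> turns the angle into a multiple of \<open>2 * pi\<close>.\<close>
  have "cheb (2 * nat q) (2 * cos (pi * (r + 1))) = 2 * cos (real (2 * nat q) * (pi * (r + 1)))"
    by (rule cheb_cos)
  also have "real (2 * nat q) * (pi * (r + 1)) = 2 * pi * of_int (p + q)"
    using pq by (simp add: field_simps)
  also have "cos (2 * pi * of_int (p + q)) = 1" by (rule cos_int_2pin)
  finally show ?thesis using pq(2) by (intro exI[of _ "2 * nat q"]) (simp add: ring_distribs)
qed

section \<open>Good triples\<close>

lemma good_orbit:
  assumes "good x"
  shows "word_act w x \<in> cube"
    and "word_act w x = (a, b, c) \<Longrightarrow>
      (\<exists>k>0. cheb k a = 2) \<and> (\<exists>k>0. cheb k b = 2) \<and> (\<exists>k>0. cheb k c = 2)"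
proof -
  have "braid_act (abs_braid3 w) x = word_act w x" by (simp add: braid_act.abs_eq)
  then obtain r1 r2 r3 where r: "r1 \<in> \<rat>" "r2 \<in> \<rat>" "r3 \<in> \<rat>"
    "word_act w x = (- 2 * cos (pi * r1), - 2 * cos (pi * r2), - 2 * cos (pi * r3))"
    using assms unfolding good_def by metis
  show "word_act w x \<in> cube"
    using cos_le_one[of "pi * r1"] cos_ge_minus_one[of "pi * r1"]
      cos_le_one[of "pi * r2"] cos_ge_minus_one[of "pi * r2"]
      cos_le_one[of "pi * r3"] cos_ge_minus_one[of "pi * r3"]
    unfolding r(4) cube_def mem_Times_iff fst_conv snd_conv atLeastAtMost_iff by linarith
  show "(\<exists>k>0. cheb k a = 2) \<and> (\<exists>k>0. cheb k b = 2) \<and> (\<exists>k>0. cheb k c = 2)"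
    if "word_act w x = (a, b, c)"
    using that r cheb_rational by auto
qed

lemma unity_angle:
  assumes "a * n = (b * k :: nat) * 2" "b > 0" "n > 0"
  shows "- 2 * cos (pi * (real a / real b)) = - 2 * Re (cis (2 * pi / real n) ^ k)"
proof -
  have "real a * real n = real b * real k * 2" using assms(1) by (metis of_nat_mult of_nat_numeral)
  then have "pi * (real a / real b) = real k * (2 * pi / real n)" using assms by (simp add: field_simps)
  then show ?thesis by (simp add: Complex.DeMoivre)
qed

lemma common_root_of_unity:
  assumes "good (x1, x2, x3)"
  obtains n \<zeta> k1 k2 k3 where "n > 0" "\<zeta> ^ n = 1"
    "x1 = - 2 * Re (\<zeta> ^ k1)" "x2 = - 2 * Re (\<zeta> ^ k2)" "x3 = - 2 * Re (\<zeta> ^ k3)"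
proof -
  have "braid_act (abs_braid3 []) (x1, x2, x3) = (x1, x2, x3)" by (simp add: braid_act.abs_eq)
  then obtain r1 r2 r3 where r: "r1 \<in> \<rat>" "r2 \<in> \<rat>" "r3 \<in> \<rat>" "0 \<le> r1" "0 \<le> r2" "0 \<le> r3"
    and x: "x1 = - 2 * cos (pi * r1)" "x2 = - 2 * cos (pi * r2)" "x3 = - 2 * cos (pi * r3)"
    using assms unfolding good_def by (metis prod.inject)
  have nat_frac: "\<exists>a b. b > 0 \<and> s = real a / real b" if "s \<in> \<rat>" "0 \<le> s" for s
  proof -
    obtain a b where "b \<noteq> 0" "\<bar>s\<bar> = real a / real b" using Rats_abs_nat_div_natE[OF \<open>s \<in> \<rat>\<close>] by metis
    then show ?thesis using \<open>0 \<le> s\<close> by auto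
  qed
  obtain a1 b1 a2 b2 a3 b3 where
    ab: "b1 > 0" "r1 = real a1 / real b1" "b2 > 0" "r2 = real a2 / real b2" "b3 > 0" "r3 = real a3 / real b3"
    using nat_frac r by metis
  \<comment> \<open>The angles \<open>pi * r\<close> become multiples of \<open>2 * pi / n\<close>
    once \<open>n\<close> is twice a common denominator. The exponents are natural numbers because
    each \<open>r\<close> is nonnegative.\<close>
  define n where "n = 2 * b1 * b2 * b3"
  have n: "n > 0" using ab by (simp add: n_def)
  show thesis
  proof (rule that[OF n])
    show "cis (2 * pi / real n) ^ n = 1" using n by (simp add: Complex.DeMoivre)
    show "x1 = - 2 * Re (cis (2 * pi / real n) ^ (a1 * b2 * b3))"
      unfolding x ab by (rule unity_angle[OF _ ab(1) n]) (simp add: n_def)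
    show "x2 = - 2 * Re (cis (2 * pi / real n) ^ (a2 * b1 * b3))"
      unfolding x ab by (rule unity_angle[OF _ ab(3) n]) (simp add: n_def)
    show "x3 = - 2 * Re (cis (2 * pi / real n) ^ (a3 * b1 * b2))"
      unfolding x ab by (rule unity_angle[OF _ ab(5) n]) (simp add: n_def)
  qed
qed

definition integral_triple :: "nat \<Rightarrow> (complex \<Rightarrow> triple) \<Rightarrow> bool" where
  "integral_triple n X \<longleftrightarrow> integral_fun n (\<lambda>z. fst (X z)) \<and>
    integral_fun n (\<lambda>z. fst (snd (X z))) \<and> integral_fun n (\<lambda>z. snd (snd (X z)))"

lemma integral_triple_beta: "integral_triple n X \<Longrightarrow> integral_triple n (\<lambda>z. beta g (X z))"
  by (cases g) (auto simp: integral_triple_def case_prod_beta intro: integral_fun_intros)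

lemma integral_triple_beta_inv: "integral_triple n X \<Longrightarrow> integral_triple n (\<lambda>z. beta_inv g (X z))"
  by (cases g) (auto simp: integral_triple_def case_prod_beta intro: integral_fun_intros)

lemma integral_triple_word_act:
  "integral_triple n X \<Longrightarrow> integral_triple n (\<lambda>z. word_act w (X z))"
  by (induction w) (auto intro: integral_triple_beta integral_triple_beta_inv)

lemma integral_fun_fricke: "integral_triple n X \<Longrightarrow> integral_fun n (\<lambda>z. fricke (X z))"
  unfolding integral_triple_def fricke_def case_prod_beta power2_eq_square
  by (elim conjE, intro integral_fun_intros)

text \<open>The index \<open>k\<close> of the Chebyshev equation may vary with the word and the
  coordinate; each equation passes to \<open>z\<close> on its own. Then \<open>fricke_le_4\<close>
  applies to the orbit of \<open>X z\<close>, and the value 4 is excluded because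
  \<open>fricke (X z) - 4\<close> is itself an \<open>integral_fun\<close>.\<close>

lemma conjugate_fricke_less_4:
  assumes X: "integral_triple n X" and \<zeta>: "\<zeta> ^ n = 1" "conjugate \<zeta> z"
    and good: "good (X \<zeta>)" "fricke (X \<zeta>) \<noteq> 4"
  shows "X z \<in> cube" "fricke (X z) < 4"
proof -
  have small: "\<bar>h z\<bar> \<le> 2" if h: "integral_fun n h" "k > 0" "cheb k (h \<zeta>) = 2" for h k
  proof -
    have "integral_fun n (\<lambda>z. cheb k (h z) - 2)"
      by (intro integral_fun_diff integral_fun_cheb integral_fun_consts h)
    from integral_fun_conjugate_eq_0[OF this \<zeta>] have "cheb k (h z) = 2" using h(3) by simp
    then show ?thesis using cheb_eq_2 h(2) by blast
  qed
  have cube: "word_act w (X z) \<in> cube" for w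
  proof -
    let ?Y = "\<lambda>z. word_act w (X z)"
    have Y: "integral_triple n ?Y" using X by (rule integral_triple_word_act)
    obtain a b c where abc: "?Y \<zeta> = (a, b, c)" by (cases "?Y \<zeta>")
    obtain k1 k2 k3 where "k1 > 0" "cheb k1 a = 2" "k2 > 0" "cheb k2 b = 2" "k3 > 0" "cheb k3 c = 2"
      using good_orbit(2)[OF good(1) abc] by blast
    then have "\<bar>fst (?Y z)\<bar> \<le> 2" "\<bar>fst (snd (?Y z))\<bar> \<le> 2" "\<bar>snd (snd (?Y z))\<bar> \<le> 2"
      using Y abc small[of "\<lambda>z. fst (?Y z)" k1] small[of "\<lambda>z. fst (snd (?Y z))" k2]
        small[of "\<lambda>z. snd (snd (?Y z))" k3]
      by (simp_all add: integral_triple_def)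
    then show ?thesis by (auto simp: cube_def mem_Times_iff abs_le_iff)
  qed
  from cube[of "[]"] show "X z \<in> cube" by simp
  have "integral_fun n (\<lambda>z. fricke (X z) - 4)"
    by (intro integral_fun_diff integral_fun_fricke X integral_fun_consts)
  from integral_fun_conjugate_eq_0[OF this \<zeta>] have "fricke (X z) \<noteq> 4" using good(2) by simp
  then show "fricke (X z) < 4" using fricke_le_4[OF cube] by simp
qed

section \<open>Roots of a triple and their finiteness\<close>

definition refl_word :: "triple \<Rightarrow> 3 list \<Rightarrow> real^3 \<Rightarrow> real^3" where
  "refl_word x l v = foldr (Refl x) l v"

text \<open>Roots are given by words rather than group elements, so the same word can be evaluated
  at a conjugate triple, where it yields the conjugate root.\<close>

definition root_set :: "triple \<Rightarrow> (real^3) set" where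
  "root_set x = {refl_word x l (axis j 1) | l j. True}"

lemma refl_word_simps [simp]:
  "refl_word x [] v = v" "refl_word x (i # l) v = Refl x i (refl_word x l v)"
  by (simp_all add: refl_word_def)

lemma refl_word_append: "refl_word x (k @ l) v = refl_word x k (refl_word x l v)"
  by (simp add: refl_word_def)

lemma refl_word_linear: "linear (refl_word x l)"
proof (induction l)
  case Nil
  then show ?case by (simp add: linear_iff)
next
  case (Cons i l)
  have "linear (Refl x i)" using Refl_in_orthogonal_group by (auto simp: orthogonal_group_def)
  from linear_compose[OF Cons this] show ?case by (simp add: comp_def)
qed

lemma refl_word_isometry: "bform x (refl_word x l u) (refl_word x l v) = bform x u v"
proof (induction l)
  case (Cons i l)
  then show ?case using Refl_in_orthogonal_group[of x i] by (simp add: orthogonal_group_def)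
qed simp

lemma refl_word_rev: "refl_word x l (refl_word x (rev l) v) = v"
  by (induction l arbitrary: v) (auto simp: refl_word_append Refl_involution)

lemma Refl_eq_refl_along: "Refl x i = refl_along (bform x) (axis i 1)"
  by (rule ext) (simp add: Refl_def refl_along_def)

lemma refl_along_refl_word:
  "refl_along (bform x) (refl_word x l (axis j 1)) = refl_word x (l @ [j] @ rev l)"
proof
  fix v
  have "refl_word x (l @ [j] @ rev l) v = refl_word x l (Refl x j (refl_word x (rev l) v))"
    by (simp add: refl_word_append)
  also have "\<dots> = refl_word x l (refl_word x (rev l) v)
      - bform x (axis j 1) (refl_word x (rev l) v) *\<^sub>R refl_word x l (axis j 1)"
    by (simp add: Refl_def linear_diff[OF refl_word_linear] linear_scale[OF refl_word_linear])
  also have "bform x (axis j 1) (refl_word x (rev l) v) = bform x (refl_word x l (axis j 1)) v"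
    by (subst refl_word_isometry[symmetric, of _ _ _ l]) (simp add: refl_word_rev)
  finally show "refl_along (bform x) (refl_word x l (axis j 1)) v = refl_word x (l @ [j] @ rev l) v"
    by (simp add: refl_along_def refl_word_rev)
qed

lemma root_set_norm: "a \<in> root_set x \<Longrightarrow> bform x a a = 2"
  by (auto simp: root_set_def refl_word_isometry bform_axis_axis gram_diag)

lemma axis_in_root_set: "axis j 1 \<in> root_set x"
  unfolding root_set_def by (rule CollectI, intro exI[of _ "[]"] exI[of _ j]) simp

lemma refl_along_root_set:
  "a \<in> root_set x \<Longrightarrow> c \<in> root_set x \<Longrightarrow> refl_along (bform x) a c \<in> root_set x"
  unfolding root_set_def by (clarsimp simp: refl_along_refl_word simp flip: refl_word_append) blast

lemma integral_fun_gram: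
  assumes "integral_triple n X" shows "integral_fun n (\<lambda>z. gram (X z) $ i $ j)"
  using exhaust_3[of i] exhaust_3[of j] assms
  by (auto simp: gram_def case_prod_beta integral_triple_def integral_fun_consts)

lemma Refl_nth: "Refl x i v $ k = v $ k - (gram x $ i $ 1 * v $ 1 + gram x $ i $ 2 * v $ 2 + gram x $ i $ 3 * v $ 3) * axis i 1 $ k"
  using exhaust_3[of i] by (auto simp: Refl_def bform_def sum_3 axis_def)

lemma integral_fun_axis: "integral_fun n (\<lambda>z. axis i 1 $ k)"
  by (cases "i = k") (auto simp: axis_def integral_fun_consts)

lemma integral_fun_refl_word:
  assumes "integral_triple n X" shows "integral_fun n (\<lambda>z. refl_word (X z) l (axis j 1) $ k)"
proof (induction l arbitrary: k)
  case Nil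
  then show ?case by (simp add: integral_fun_axis)
next
  case (Cons i l)
  show ?case unfolding refl_word_simps Refl_nth
    by (intro integral_fun_diff integral_fun_mult integral_fun_add integral_fun_gram
        integral_fun_axis Cons assms)
qed

text \<open>A root keeps norm 2 at every conjugate, where the form is definite too, so its
  coordinates are bounded at all the finitely many conjugates at once;
  \<open>finite_integral_fun_values\<close> then applies to each coordinate.\<close>

lemma finite_root_set:
  assumes "good (x1, x2, x3)" "fricke (x1, x2, x3) \<noteq> 4"
  shows "finite (root_set (x1, x2, x3))"
proof -
  obtain n \<zeta> k1 k2 k3 where n: "n > 0" and \<zeta>: "\<zeta> ^ n = 1" and
    x: "x1 = - 2 * Re (\<zeta> ^ k1)" "x2 = - 2 * Re (\<zeta> ^ k2)" "x3 = - 2 * Re (\<zeta> ^ k3)"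
    using common_root_of_unity[OF assms(1)] by metis
  define X where "X z = (- 2 * Re (z ^ k1), - 2 * Re (z ^ k2), - 2 * Re (z ^ k3))" for z :: complex
  have X\<zeta>: "X \<zeta> = (x1, x2, x3)" by (simp add: X_def x)
  have X: "integral_triple n X"
    unfolding integral_triple_def X_def fst_conv snd_conv using integral_fun_Re_power[OF n] by blast
  have small: "X z \<in> cube" "fricke (X z) < 4" if "conjugate \<zeta> z" for z
    using conjugate_fricke_less_4[OF X \<zeta> that] assms X\<zeta> by simp_all
  have fin: "finite {z. conjugate \<zeta> z}"
  proof (rule finite_subset)
    show "{z. conjugate \<zeta> z} \<subseteq> {z. z ^ n = 1}" using conjugate_unity \<zeta> by blast
    show "finite {z :: complex. z ^ n = 1}" using n by (intro finite_roots_unity) simp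
  qed
  have "\<forall>z\<in>{z. conjugate \<zeta> z}. \<exists>B. \<forall>v. bform (X z) v v = 2 \<longrightarrow> norm v \<le> B"
    using bform_bounded small by blast
  then obtain B where B: "\<And>z v. conjugate \<zeta> z \<Longrightarrow> bform (X z) v v = 2 \<Longrightarrow> norm v \<le> B z"
    by (metis (mono_tags, lifting) mem_Collect_eq)
  define C where "C = (\<Sum>z | conjugate \<zeta> z. \<bar>B z\<bar>)"
  have C: "\<bar>v $ k\<bar> \<le> C" if "conjugate \<zeta> z" "bform (X z) v v = 2" for z v k
  proof -
    have "\<bar>v $ k\<bar> \<le> norm v" by (rule component_le_norm_cart)
    also have "\<dots> \<le> \<bar>B z\<bar>" using B[OF that] by simp
    also have "\<dots> \<le> C" unfolding C_def using fin that by (intro member_le_sum) auto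
    finally show ?thesis .
  qed
  define V where "V = {h \<zeta> | h. integral_fun n h \<and> (\<forall>z. conjugate \<zeta> z \<longrightarrow> \<bar>h z\<bar> \<le> C)}"
  have "root_set (x1, x2, x3) \<subseteq> (\<lambda>(a, b, c). vector [a, b, c]) ` (V \<times> V \<times> V)"
  proof
    fix v assume "v \<in> root_set (x1, x2, x3)"
    then obtain l j where v: "v = refl_word (X \<zeta>) l (axis j 1)" by (auto simp: root_set_def X\<zeta>)
    have "v $ k \<in> V" for k
      unfolding V_def v
      by (rule CollectI, intro exI[of _ "\<lambda>z. refl_word (X z) l (axis j 1) $ k"] conjI allI impI)
        (auto intro!: integral_fun_refl_word X C simp: refl_word_isometry bform_axis_axis gram_diag)
    moreover have "v = vector [v $ 1, v $ 2, v $ 3]" by (simp add: vec_eq_iff forall_3)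
    ultimately show "v \<in> (\<lambda>(a, b, c). vector [a, b, c]) ` (V \<times> V \<times> V)"
      by (intro image_eqI[of _ _ "(v $ 1, v $ 2, v $ 3)"]) auto
  qed
  moreover have "finite V" unfolding V_def by (rule finite_integral_fun_values[OF n \<zeta>])
  ultimately show ?thesis by (meson finite_SigmaI finite_imageI finite_subset)
qed

text \<open>The functional is evaluation at \<open>t\<close> of the polynomial with coefficients
  \<open>v\<close>; each nonzero \<open>v\<close> excludes only finitely many
  \<open>t\<close>.\<close>

lemma generic_functional:
  fixes A :: "(real^3) set"
  assumes "finite A" "0 \<notin> A"
  shows "\<exists>f :: real^3 \<Rightarrow> real. linear f \<and> (\<forall>v\<in>A. f v \<noteq> 0)"
proof -
  let ?p = "\<lambda>v :: real^3. [:v $ 1, v $ 2, v $ 3:]"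
  have "finite (\<Union>v\<in>A. {t. poly (?p v) t = 0})"
  proof (intro finite_UN_I assms(1) poly_roots_finite)
    fix v assume "v \<in> A"
    then have "v \<noteq> 0" using assms(2) by auto
    then show "?p v \<noteq> 0" by (auto simp: vec_eq_iff forall_3)
  qed
  then obtain t where "t \<notin> (\<Union>v\<in>A. {t. poly (?p v) t = 0})"
    using ex_new_if_finite infinite_UNIV_char_0 by blast
  then have "\<forall>v\<in>A. poly (?p v) t \<noteq> 0" by auto
  moreover have "linear (\<lambda>v. poly (?p v) t)" by (rule linearI) (simp_all add: algebra_simps)
  ultimately show ?thesis by blast
qed

text \<open>A nonzero Gram entry forces two basis vectors into the same subspace, and no basis
  vector lies in both because its norm is 2. Admissibility leaves at least two nonzero entries,
  enough to connect all three basis vectors.\<close>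

lemma root_set_irreducible:
  assumes adm: "admissible x"
    and UV: "subspace U" "subspace V" "\<And>u v. u \<in> U \<Longrightarrow> v \<in> V \<Longrightarrow> bform x u v = 0"
      "root_set x \<subseteq> U \<union> V"
  shows "root_set x \<subseteq> U \<or> root_set x \<subseteq> V"
proof -
  obtain x1 x2 x3 where x: "x = (x1, x2, x3)" by (cases x)
  have all: "W = UNIV" if W: "subspace W" "\<And>j. axis j 1 \<in> W" for W :: "(real^3) set"
  proof -
    have "v \<in> W" for v
    proof -
      have "v = (\<Sum>i\<in>UNIV. v $ i *\<^sub>R axis i 1)"
        by (simp add: vec_eq_iff forall_3 sum_3 axis_def)
      also have "\<dots> \<in> W" using W by (intro subspace_sum subspace_scale) auto
      finally show ?thesis .
    qed
    then show ?thesis by blast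
  qed
  have edge: "(axis i 1 \<in> U \<and> axis j 1 \<in> U) \<or> (axis i 1 \<in> V \<and> axis j 1 \<in> V)"
    if "gram x $ i $ j \<noteq> 0" for i j
    using that UV(3)[of "axis i 1" "axis j 1"] UV(3)[of "axis j 1" "axis i 1"] UV(4)
      axis_in_root_set[of i x] axis_in_root_set[of j x]
    by (auto simp: bform_axis_axis gram_sym[of x j i])
  have disj: "\<not> (axis i 1 \<in> U \<and> axis i 1 \<in> V)" for i
    using UV(3)[of "axis i 1" "axis i 1"] by (auto simp: bform_axis_axis gram_diag)
  have g: "gram x $ 1 $ 2 = x1" "gram x $ 2 $ 3 = x2" "gram x $ 1 $ 3 = x3"
    by (simp_all add: x gram_def)
  have "(axis 1 1 \<in> U \<and> axis 2 1 \<in> U \<and> axis 3 1 \<in> U) \<or> (axis 1 1 \<in> V \<and> axis 2 1 \<in> V \<and> axis 3 1 \<in> V)"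
  proof -
    have "x1 \<noteq> 0 \<and> x2 \<noteq> 0 \<or> x2 \<noteq> 0 \<and> x3 \<noteq> 0 \<or> x1 \<noteq> 0 \<and> x3 \<noteq> 0"
      using adm by (auto simp: admissible_def x)
    then show ?thesis
      using edge[of 1 2] edge[of 2 3] edge[of 1 3] disj[of 1] disj[of 2] disj[of 3]
      unfolding g by argo
  qed
  then show ?thesis
  proof (elim disjE)
    assume "axis 1 1 \<in> U \<and> axis 2 1 \<in> U \<and> axis 3 1 \<in> U"
    then have "U = UNIV" using all[OF UV(1)] exhaust_3 by metis
    then show ?thesis by simp
  next
    assume "axis 1 1 \<in> V \<and> axis 2 1 \<in> V \<and> axis 3 1 \<in> V"
    then have "V = UNIV" using all[OF UV(2)] exhaust_3 by metis
    then show ?thesis by simp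
  qed
qed

lemma refl_word_in_carrier: "refl_word x l \<in> carrier (reflection_group x)"
proof (induction l)
  case Nil
  interpret group "reflection_group x"
    unfolding reflection_group_def by (rule group.group_subgroup_generated[OF group_orthogonal_group])
  have "\<one>\<^bsub>reflection_group x\<^esub> = refl_word x []"
    by (auto simp: reflection_group_def orthogonal_group_def)
  then show ?case using one_closed by metis
next
  case (Cons i l)
  interpret O: group "orthogonal_group x" by (rule group_orthogonal_group)
  interpret group "reflection_group x"
    unfolding reflection_group_def by (rule O.group_subgroup_generated)
  have "Refl x i \<in> carrier (reflection_group x)"
    using exhaust_3[of i] Refl_in_orthogonal_group[of x]
    by (auto simp: reflection_group_def carrier_subgroup_generated intro!: generate.incl)
  from m_closed[OF this Cons]
  show ?case by (simp add: reflection_group_def orthogonal_group_def comp_def)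
qed

theorem theorem1p8:
  fixes x1 x2 x3 :: real
  assumes "good (x1, x2, x3)"
    and "x1^2 + x2^2 + x3^2 - x1 * x2 * x3 \<noteq> 4"
  shows "irreducible_finite_coxeter_group (x1, x2, x3) (reflection_group (x1, x2, x3))"
proof -
  define x where "x = (x1, x2, x3)"
  let ?G = "reflection_group x" and ?R = "{Refl x 1, Refl x 2, Refl x 3}"
  have good: "good x" "fricke x \<noteq> 4" using assms by (simp_all add: x_def fricke_def)
  have fin: "finite (root_set x)" using finite_root_set good unfolding x_def by blast
  have "0 \<notin> root_set x" using root_set_norm[of 0 x] by (auto simp: bform_def)
  then obtain f :: "real^3 \<Rightarrow> real" where f: "linear f" "\<And>v. v \<in> root_set x \<Longrightarrow> f v \<noteq> 0"
    using generic_functional[OF fin] by blast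
  interpret O: group "orthogonal_group x" by (rule group_orthogonal_group)
  interpret root_system_group "bform x" "root_set x" f ?G ?R
  proof (intro root_system_group.intro root_system.intro root_system_group_axioms.intro)
    show "group ?G" unfolding reflection_group_def by (rule O.group_subgroup_generated)
    show "(\<otimes>\<^bsub>?G\<^esub>) = (\<circ>)" "\<one>\<^bsub>?G\<^esub> = id"
      by (simp_all add: reflection_group_def orthogonal_group_def)
    show "refl_along (bform x) a \<in> carrier ?G" if "a \<in> root_set x" for a
      using that refl_word_in_carrier[of x] unfolding root_set_def by (auto simp only: refl_along_refl_word)
    show "?R \<subseteq> refl_along (bform x) ` root_set x"
      using axis_in_root_set by (auto simp: Refl_eq_refl_along)
    \<comment> \<open>Generation by \<open>?R\<close> is known inside the orthogonal group;
      \<open>subgroup_generated2\<close> transfers it to \<open>?G\<close> itself, whose carrier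
      must contain \<open>?R\<close>.\<close>
    have "?R \<subseteq> carrier ?G"
      using refl_word_in_carrier[of x "[_]"] by (auto simp: refl_word_def[abs_def])
    then show "generate ?G ?R = carrier ?G"
      using carrier_subgroup_generated[of ?G ?R] O.subgroup_generated2[of ?R]
      by (simp add: reflection_group_def Int_absorb1)
  qed (use f fin in \<open>auto simp: bform_linear bform_sym root_set_norm refl_along_root_set\<close>)
  have "finite (carrier ?G)"
  proof (rule finite_imageD)
    \<comment> \<open>A linear map is determined by its values on the basis, and for elements of the
      group these are roots.\<close>
    let ?e = "\<lambda>g :: real^3 \<Rightarrow> real^3. (g (axis 1 1), g (axis 2 1), g (axis 3 1))"
    have "g (axis j 1) \<in> root_set x" if g: "g \<in> carrier ?G" for g j
    proof -
      obtain as where "as \<in> lists simple" "g = act as" using carrier_act[OF g] by blast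
      then show ?thesis using act_root[OF simple_lists axis_in_root_set] by simp
    qed
    then have "?e ` carrier ?G \<subseteq> root_set x \<times> root_set x \<times> root_set x" by blast
    then show "finite (?e ` carrier ?G)" using fin by (meson finite_SigmaI finite_subset)
    show "inj_on ?e (carrier ?G)"
    proof (rule inj_onI)
      fix g h assume gh: "g \<in> carrier ?G" "h \<in> carrier ?G" "?e g = ?e h"
      obtain as bs where "g = act as" "h = act bs" using carrier_act[OF gh(1)] carrier_act[OF gh(2)] by blast
      then have lin: "linear g" "linear h" by (simp_all add: act_linear)
      have "g b = h b" if b: "b \<in> Basis" for b
      proof -
        obtain j where "b = axis j 1" using b by (auto simp: Basis_vec_def)
        moreover have "j = 1 \<or> j = 2 \<or> j = 3" by (rule exhaust_3)
        moreover have "g (axis 1 1) = h (axis 1 1)" "g (axis 2 1) = h (axis 2 1)" "g (axis 3 1) = h (axis 3 1)"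
          using gh(3) by simp_all
        ultimately show ?thesis by (elim disjE) simp_all
      qed
      then show "g = h" using linear_eq_stdbasis lin by blast
    qed
  qed
  moreover have "refl ` simple \<subseteq> reflections x"
  proof
    fix s assume "s \<in> refl ` simple"
    then obtain a where "a \<in> root_set x" "s = refl a" using simple_root by blast
    then show "s \<in> reflections x"
      unfolding reflections_def
      by (intro CollectI exI[of _ a]) (auto simp: refl_along_def root_set_norm fun_eq_iff)
  qed
  moreover have "coxeter_irreducible (refl ` simple) cmat"
  proof (rule coxeter_irreducible_cmat)
    show "root_set x \<noteq> {}" using axis_in_root_set by blast
    have "admissible x" using good(1) by (simp add: good_def)
    then show "root_set x \<subseteq> U \<or> root_set x \<subseteq> V"
      if "subspace U" "subspace V" "\<And>u v. u \<in> U \<Longrightarrow> v \<in> V \<Longrightarrow> bform x u v = 0"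
        "root_set x \<subseteq> U \<union> V" for U V
      using root_set_irreducible that by blast
  qed
  ultimately show ?thesis
    unfolding irreducible_finite_coxeter_group_def x_def[symmetric] using coxeter_system_cmat by blast
qed

end
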